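(* Let $P$ be a subsemigroup of a countable discrete group $G$. If there exist $p,q\in P$ with $pP\cap qP = \emptyset$, then the transformation groupoid $G\ltimes\partial\Omega_P$ is purely infinite.
   Context: $S = I_l(P)$ is the inverse semigroup of partial bijections of $P$ generated by the maps $p : P \to pP$, $x\mapsto px$ ($p \in P$), together with the empty map $0$. Its semilattice of idempotents $E$ is identified with the set $\mathcal{J} = \{p_1^{-1}q_1\cdots p_n^{-1}q_nP : p_i,q_i\in P\}\cup\{\emptyset\}$ of constructible right ideals of $P$ under intersection (here $qX=\{qx : x\in X\}$, $p^{-1}X = \{y \in P : py\in X\}$). Put $S^\times = S\setminus\{0\}$; for $s \in S^\times$ there is a unique $\sigma(s)\in G$ with $s(x) = \sigma(s)x$ for all $x$ in the domain of $s$. $\widehat{E}$ is the space of non-zero maps $\chi : \mathcal{J}\to\{0,1\}$ with $\chi(X\cap Y) = \chi(X)\chi(Y)$ and $\chi(\emptyset) = 0$, with the topology of pointwise convergence. $G$ acts partially on $\widehat{E}$: $g\in G$ has domain $U_{g^{-1}} = \{\chi : \chi(\mathrm{dom}(s)) = 1 \text{ for some } s\in S^\times \text{ with } \sigma(s) = g\}$, and $(g.\chi)(X) = \chi(s^{-1}(X\cap\mathrm{im}(s)))$ for such $s$. $\widehat{E}_{\max}$ is the set of $\chi\in\widehat{E}$ for which $\{X\in\mathcal{J} : \chi(X)=1\}$ is maximal (with respect to inclusion), and $\partial\Omega_P := \partial\widehat{E} := \overline{\widehat{E}_{\max}}$, a closed $G$-invariant subspace; $G\curvearrowright\partial\Omega_P$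 is the restricted partial action. The transformation groupoid is $G\ltimes\partial\Omega_P = \{(g,\chi)\in G\times\partial\Omega_P : \chi\in U_{g^{-1}}\}$ with the subspace topology, $s(g,\chi) = \chi$, $r(g,\chi) = g.\chi$, $(g_1,g_2.\chi)(g_2,\chi) = (g_1g_2,\chi)$, $(g,\chi)^{-1}=(g^{-1},g.\chi)$. An étale groupoid $\mathcal{G}$ with totally disconnected unit space is purely infinite (in the sense of Matui) if for every compact open set $A\subseteq\mathcal{G}^{(0)}$ there exist compact open bisections $U,V\subseteq\mathcal{G}$ with $s(U) = s(V) = A$, $r(U)\cup r(V)\subseteq A$ and $r(U)\cap r(V) = \emptyset$. *)

theory Defs
  imports "HOL-Analysis.Analysis" "HOL-Algebra.Coset"
begin

section \<open>Topological groupoids and pure infiniteness\<close>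

text \<open>
  Arrows and units are separate topological spaces; the unit space is embedded into the
  arrow space by \<open>ident\<close>.  The product \<open>gmult a b\<close> is meaningful only if
  \<open>src a = rng b\<close>.
\<close>

record ('a, 'o) groupoid_data =
  arrows :: "'a topology"
  units :: "'o topology"
  src :: "'a \<Rightarrow> 'o"
  rng :: "'a \<Rightarrow> 'o"
  ident :: "'o \<Rightarrow> 'a"
  gmult :: "'a \<Rightarrow> 'a \<Rightarrow> 'a"
  ginv :: "'a \<Rightarrow> 'a"

definition composable :: "('a, 'o) groupoid_data \<Rightarrow> ('a \<times> 'a) set" where
  "composable \<G> = {(a, b). a \<in> topspace (arrows \<G>) \<and> b \<in> topspace (arrows \<G>) \<and> src \<G> a = rng \<G> b}"

locale topological_groupoid =
  fixes \<G> :: "('a, 'o) groupoid_data"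
  assumes continuous_src: "continuous_map (arrows \<G>) (units \<G>) (src \<G>)"
    and continuous_rng: "continuous_map (arrows \<G>) (units \<G>) (rng \<G>)"
    and continuous_ident: "continuous_map (units \<G>) (arrows \<G>) (ident \<G>)"
    and continuous_ginv: "continuous_map (arrows \<G>) (arrows \<G>) (ginv \<G>)"
    and continuous_gmult:
      "continuous_map (subtopology (prod_topology (arrows \<G>) (arrows \<G>)) (composable \<G>))
         (arrows \<G>) (\<lambda>(a, b). gmult \<G> a b)"
    and src_ident: "x \<in> topspace (units \<G>) \<Longrightarrow> src \<G> (ident \<G> x) = x"
    and rng_ident: "x \<in> topspace (units \<G>) \<Longrightarrow> rng \<G> (ident \<G> x) = x"
    and src_gmult: "(a, b) \<in> composable \<G> \<Longrightarrow> src \<G> (gmult \<G> a b) = src \<G> b"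
    and rng_gmult: "(a, b) \<in> composable \<G> \<Longrightarrow> rng \<G> (gmult \<G> a b) = rng \<G> a"
    and gmult_assoc: "(a, b) \<in> composable \<G> \<Longrightarrow> (b, c) \<in> composable \<G> \<Longrightarrow>
      gmult \<G> (gmult \<G> a b) c = gmult \<G> a (gmult \<G> b c)"
    and gmult_ident_right:
      "a \<in> topspace (arrows \<G>) \<Longrightarrow> gmult \<G> a (ident \<G> (src \<G> a)) = a"
    and gmult_ident_left:
      "a \<in> topspace (arrows \<G>) \<Longrightarrow> gmult \<G> (ident \<G> (rng \<G> a)) a = a"
    and src_ginv: "a \<in> topspace (arrows \<G>) \<Longrightarrow> src \<G> (ginv \<G> a) = rng \<G> a"
    and rng_ginv: "a \<in> topspace (arrows \<G>) \<Longrightarrow> rng \<G> (ginv \<G> a) = src \<G> a"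
    and ginv_left:
      "a \<in> topspace (arrows \<G>) \<Longrightarrow> gmult \<G> (ginv \<G> a) a = ident \<G> (src \<G> a)"
    and ginv_right:
      "a \<in> topspace (arrows \<G>) \<Longrightarrow> gmult \<G> a (ginv \<G> a) = ident \<G> (rng \<G> a)"

definition local_homeomorphism_map :: "'a topology \<Rightarrow> 'b topology \<Rightarrow> ('a \<Rightarrow> 'b) \<Rightarrow> bool" where
  "local_homeomorphism_map X Y f \<longleftrightarrow>
     (\<forall>x\<in>topspace X. \<exists>U. openin X U \<and> x \<in> U \<and> openin Y (f ` U) \<and>
        homeomorphic_map (subtopology X U) (subtopology Y (f ` U)) f)"

text \<open>As usual for groupoids in operator algebras, etale groupoids are locally compact Hausdorff.\<close>

locale etale_groupoid = topological_groupoid +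
  assumes Hausdorff: "Hausdorff_space (arrows \<G>)"
    and locally_compact: "locally_compact_space (arrows \<G>)"
    and local_homeomorphism_src: "local_homeomorphism_map (arrows \<G>) (units \<G>) (src \<G>)"
    and local_homeomorphism_rng: "local_homeomorphism_map (arrows \<G>) (units \<G>) (rng \<G>)"

definition totally_disconnected_top :: "'a topology \<Rightarrow> bool" where
  "totally_disconnected_top X \<longleftrightarrow> (\<forall>C. connectedin X C \<longrightarrow> (\<forall>x\<in>C. \<forall>y\<in>C. x = y))"

definition compact_open_bisection :: "('a, 'o) groupoid_data \<Rightarrow> 'a set \<Rightarrow> bool" where
  "compact_open_bisection \<G> U \<longleftrightarrow>
     compactin (arrows \<G>) U \<and> openin (arrows \<G>) U \<and> inj_on (src \<G>) U \<and> inj_on (rng \<G>) U"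

definition purely_infinite :: "('a, 'o) groupoid_data \<Rightarrow> bool" where
  "purely_infinite \<G> \<longleftrightarrow>
     etale_groupoid \<G> \<and> totally_disconnected_top (units \<G>) \<and>
     (\<forall>A. compactin (units \<G>) A \<and> openin (units \<G>) A \<longrightarrow>
       (\<exists>U V. compact_open_bisection \<G> U \<and> compact_open_bisection \<G> V \<and>
          src \<G> ` U = A \<and> src \<G> ` V = A \<and>
          rng \<G> ` U \<union> rng \<G> ` V \<subseteq> A \<and> rng \<G> ` U \<inter> rng \<G> ` V = {}))"


section \<open>The left inverse hull and constructible right ideals\<close>

text \<open>
  A partial bijection \<open>s\<close> is represented by its graph \<open>{(x, s(x)) | x \<in> dom(s)}\<close>, so that
  \<open>dom(s)\<close>, \<open>im(s)\<close> and the inverse of \<open>s\<close> are \<open>Domain s\<close>, \<open>Range s\<close> and \<open>converse s\<close>, and the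
  composite \<open>s \<circ> t\<close> (first \<open>t\<close>, then \<open>s\<close>) is \<open>t O s\<close>.
\<close>

inductive_set left_inverse_hull :: "('a, 'b) monoid_scheme \<Rightarrow> 'a set \<Rightarrow> ('a \<times> 'a) set set"
  for G P where
  gen: "p \<in> P \<Longrightarrow> {(x, p \<otimes>\<^bsub>G\<^esub> x) | x. x \<in> P} \<in> left_inverse_hull G P"
| zero: "{} \<in> left_inverse_hull G P"
| comp: "s \<in> left_inverse_hull G P \<Longrightarrow> t \<in> left_inverse_hull G P \<Longrightarrow> t O s \<in> left_inverse_hull G P"
| inv: "s \<in> left_inverse_hull G P \<Longrightarrow> converse s \<in> left_inverse_hull G P"

definition translation_part :: "('a, 'b) monoid_scheme \<Rightarrow> ('a \<times> 'a) set \<Rightarrow> 'a" where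
  "translation_part G s = (THE g. g \<in> carrier G \<and> (\<forall>(x, y)\<in>s. y = g \<otimes>\<^bsub>G\<^esub> x))"

definition preimage_ideal :: "('a, 'b) monoid_scheme \<Rightarrow> 'a set \<Rightarrow> 'a \<Rightarrow> 'a set \<Rightarrow> 'a set" where
  "preimage_ideal G P p X = {y \<in> P. p \<otimes>\<^bsub>G\<^esub> y \<in> X}"

definition constructible_ideals :: "('a, 'b) monoid_scheme \<Rightarrow> 'a set \<Rightarrow> 'a set set" where
  "constructible_ideals G P =
     {foldr (\<lambda>(p, q) X. preimage_ideal G P p (q <#\<^bsub>G\<^esub> X)) pqs P | pqs. set pqs \<subseteq> P \<times> P} \<union> {{}}"


section \<open>The character space and its boundary\<close>

text \<open>Characters are extensional functions on \<open>constructible_ideals G P\<close>, as elements of the product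
  space \<open>{0,1}\<^sup>J\<close> have to be.\<close>

definition characters :: "('a, 'b) monoid_scheme \<Rightarrow> 'a set \<Rightarrow> ('a set \<Rightarrow> nat) set" where
  "characters G P =
     {\<omega> \<in> constructible_ideals G P \<rightarrow>\<^sub>E {0, 1}.
        (\<forall>X\<in>constructible_ideals G P. \<forall>Y\<in>constructible_ideals G P. \<omega> (X \<inter> Y) = \<omega> X * \<omega> Y) \<and>
        \<omega> {} = 0 \<and> (\<exists>X\<in>constructible_ideals G P. \<omega> X \<noteq> 0)}"

definition character_space :: "('a, 'b) monoid_scheme \<Rightarrow> 'a set \<Rightarrow> ('a set \<Rightarrow> nat) topology" where
  "character_space G P =
     subtopology (product_topology (\<lambda>_. discrete_topology {0, 1}) (constructible_ideals G P))
       (characters G P)"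

definition char_filter :: "('a, 'b) monoid_scheme \<Rightarrow> 'a set \<Rightarrow> ('a set \<Rightarrow> nat) \<Rightarrow> 'a set set" where
  "char_filter G P \<omega> = {X \<in> constructible_ideals G P. \<omega> X = 1}"

definition maximal_characters :: "('a, 'b) monoid_scheme \<Rightarrow> 'a set \<Rightarrow> ('a set \<Rightarrow> nat) set" where
  "maximal_characters G P =
     {\<omega> \<in> characters G P. \<forall>\<psi>\<in>characters G P.
        char_filter G P \<omega> \<subseteq> char_filter G P \<psi> \<longrightarrow> char_filter G P \<omega> = char_filter G P \<psi>}"

definition boundary :: "('a, 'b) monoid_scheme \<Rightarrow> 'a set \<Rightarrow> ('a set \<Rightarrow> nat) set" where
  "boundary G P = character_space G P closure_of maximal_characters G P"


section \<open>The partial action and its transformation groupoid\<close>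

definition implements ::
  "('a, 'b) monoid_scheme \<Rightarrow> 'a set \<Rightarrow> 'a \<Rightarrow> ('a set \<Rightarrow> nat) \<Rightarrow> ('a \<times> 'a) set \<Rightarrow> bool" where
  "implements G P g \<omega> s \<longleftrightarrow>
     s \<in> left_inverse_hull G P - {{}} \<and> translation_part G s = g \<and> \<omega> (Domain s) = 1"

text \<open>The domain \<open>U\<close> with index \<open>g\<^sup>-\<^sup>1\<close> of the partial homeomorphism given by \<open>g\<close>.\<close>

definition action_domain :: "('a, 'b) monoid_scheme \<Rightarrow> 'a set \<Rightarrow> 'a \<Rightarrow> ('a set \<Rightarrow> nat) set" where
  "action_domain G P g = {\<omega> \<in> characters G P. \<exists>s. implements G P g \<omega> s}"

text \<open>The value does not depend on the chosen \<open>s\<close>; \<open>converse s `` Y\<close> is the preimage of \<open>Y\<close> under \<open>s\<close>.\<close>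

definition partial_action ::
  "('a, 'b) monoid_scheme \<Rightarrow> 'a set \<Rightarrow> 'a \<Rightarrow> ('a set \<Rightarrow> nat) \<Rightarrow> ('a set \<Rightarrow> nat)" where
  "partial_action G P g \<omega> =
     (let s = SOME s. implements G P g \<omega> s
      in restrict (\<lambda>X. \<omega> (converse s `` (X \<inter> Range s))) (constructible_ideals G P))"

definition boundary_groupoid ::
  "('a, 'b) monoid_scheme \<Rightarrow> 'a set \<Rightarrow> ('a \<times> ('a set \<Rightarrow> nat), 'a set \<Rightarrow> nat) groupoid_data" where
  "boundary_groupoid G P =
     \<lparr>arrows = subtopology
        (prod_topology (discrete_topology (carrier G)) (subtopology (character_space G P) (boundary G P)))
        {(g, \<omega>). g \<in> carrier G \<and> \<omega> \<in> boundary G P \<and> \<omega> \<in> action_domain G P g},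
      units = subtopology (character_space G P) (boundary G P),
      src = (\<lambda>(g, \<omega>). \<omega>),
      rng = (\<lambda>(g, \<omega>). partial_action G P g \<omega>),
      ident = (\<lambda>\<omega>. (\<one>\<^bsub>G\<^esub>, \<omega>)),
      gmult = (\<lambda>(g, _) (h, \<omega>). (g \<otimes>\<^bsub>G\<^esub> h, \<omega>)),
      ginv = (\<lambda>(g, \<omega>). (inv\<^bsub>G\<^esub> g, partial_action G P g \<omega>))\<rparr>"

end

(* A nonempty open subset A of the boundary contains a maximal character \<omega>.  By maximality every
   constructible ideal on which \<omega> vanishes is disjoint from one on which \<omega> is 1, so A contains all
   boundary characters that take the value 1 at a suitable nonempty constructible ideal X.  For x in X
   the ideals xpP and xqP are disjoint subsets of the right ideal X, and left translations by elements
   of P are defined on the whole boundary.  Hence xp and xq move all of A into disjoint parts of A. *)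

theory Submission
  imports Defs
begin

section \<open>Subspaces of products of discrete spaces\<close>

text \<open>Translation by r in P has domain P, and every character is 1 at P, since it is 1
  somewhere and P is the largest constructible ideal. So the domain condition is automatic for
  elements of P and a whole set can be moved at once. The translate of any character by r is 1 at
  rP; this turns inclusion and disjointness of ideals into statements about characters.

  Pure infiniteness includes that the groupoid is etale, which takes more room than the two
  bisections. The obstacle is that the action is defined through an arbitrarily chosen partial
  bijection s whose domain varies with the group element. One observation meets it: all admissible s
  give the same value, and an s that is admissible at \<omega> stays admissible at every character
  with the same value at dom(s). Hence finitely many coordinates control the action near a point,
  and invariance of the closure, continuity and openness of the domains all reduce to this.

  P may lack the identity element. The identity map of P still lies in the hull, as a translation
  followed by its converse, and the point x of the ideal enters only through the products xp and
  xq.\<close>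

lemma openin_subtopology_product_discrete:
  "openin (subtopology (product_topology (\<lambda>_. discrete_topology D) J) B) A \<longleftrightarrow>
     A \<subseteq> B \<inter> (J \<rightarrow>\<^sub>E D) \<and>
     (\<forall>f\<in>A. \<exists>F. finite F \<and> F \<subseteq> J \<and>
        (\<forall>h\<in>B \<inter> (J \<rightarrow>\<^sub>E D). (\<forall>i\<in>F. h i = f i) \<longrightarrow> h \<in> A))" (is "?L \<longleftrightarrow> ?R")
proof
  let ?T = "product_topology (\<lambda>_. discrete_topology D) J"
  assume ?L
  then obtain W where W: "openin ?T W" "A = W \<inter> B"
    by (auto simp: openin_subtopology)
  have sub: "W \<subseteq> (J \<rightarrow>\<^sub>E D)"
    using openin_subset[OF W(1)] by simp
  have "\<exists>F. finite F \<and> F \<subseteq> J \<and> (\<forall>h\<in>B \<inter> (J \<rightarrow>\<^sub>E D). (\<forall>i\<in>F. h i = f i) \<longrightarrow> h \<in> A)"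
    if "f \<in> A" for f
  proof -
    have "f \<in> W" using that W by auto
    then obtain U where U: "finite {i \<in> J. U i \<noteq> D}" "\<forall>i\<in>J. U i \<subseteq> D"
      "f \<in> Pi\<^sub>E J U" "Pi\<^sub>E J U \<subseteq> W"
      using W(1) by (auto simp: openin_product_topology_alt)
    have "h \<in> A" if "h \<in> B \<inter> (J \<rightarrow>\<^sub>E D)" "\<forall>i\<in>{i \<in> J. U i \<noteq> D}. h i = f i" for h
    proof -
      have "h \<in> Pi\<^sub>E J U"
      proof (rule PiE_I)
        show "h i \<in> U i" if "i \<in> J" for i
          using that \<open>\<forall>i\<in>{i \<in> J. U i \<noteq> D}. h i = f i\<close> \<open>h \<in> B \<inter> (J \<rightarrow>\<^sub>E D)\<close> U(3)
          by (cases "U i = D") (auto simp: PiE_iff)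
      qed (use \<open>h \<in> B \<inter> (J \<rightarrow>\<^sub>E D)\<close> in \<open>auto simp: PiE_iff extensional_def\<close>)
      then show ?thesis using U(4) W(2) that by auto
    qed
    then show ?thesis using U(1) by (intro exI[of _ "{i \<in> J. U i \<noteq> D}"]) auto
  qed
  then show ?R using sub W(2) by auto
next
  let ?T = "product_topology (\<lambda>_. discrete_topology D) J"
  assume R: ?R
  have "\<exists>W. openin (subtopology ?T B) W \<and> f \<in> W \<and> W \<subseteq> A" if "f \<in> A" for f
  proof -
    obtain F where F: "finite F" "F \<subseteq> J"
      "\<And>h. h \<in> B \<inter> (J \<rightarrow>\<^sub>E D) \<Longrightarrow> (\<forall>i\<in>F. h i = f i) \<Longrightarrow> h \<in> A"
      using bspec[OF conjunct2[OF R] \<open>f \<in> A\<close>] by blast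
    \<comment> \<open>Singletons are open in a discrete factor, so pinning the coordinates in F and
      leaving the others free gives a basic open box around f.\<close>
    define U where "U i = (if i \<in> F then {f i} else D)" for i
    have f: "f \<in> J \<rightarrow>\<^sub>E D" "f \<in> B" using R that by auto
    have "openin ?T (Pi\<^sub>E J U)"
      unfolding openin_PiE_gen
    proof (intro disjI2 conjI ballI)
      show "finite {i \<in> J. U i \<noteq> topspace (discrete_topology D)}"
        by (rule finite_subset[OF _ F(1)]) (auto simp: U_def)
      show "openin (discrete_topology D) (U i)" if "i \<in> J" for i
        using f that F(2) by (auto simp: U_def PiE_iff)
    qed
    then have "openin (subtopology ?T B) (Pi\<^sub>E J U \<inter> B)"
      by (auto simp: openin_subtopology)
    moreover have "f \<in> Pi\<^sub>E J U \<inter> B"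
      using f by (auto simp: U_def PiE_iff)
    moreover have "Pi\<^sub>E J U \<inter> B \<subseteq> A"
    proof
      fix h assume h: "h \<in> Pi\<^sub>E J U \<inter> B"
      have "h i = f i" if "i \<in> F" for i
        using h that F(2) by (auto simp: U_def PiE_iff split: if_splits)
      moreover have "h i \<in> D" if "i \<in> J" for i
        using h that f by (cases "i \<in> F") (auto simp: U_def PiE_iff)
      ultimately show "h \<in> A" using h by (intro F(3)) (auto simp: PiE_iff)
    qed
    ultimately show ?thesis by blast
  qed
  then show ?L by (subst openin_subopen) blast
qed

section \<open>The left inverse hull and constructible ideals\<close>

locale group_subsemigroup = group G for G (structure) +
  fixes P :: "'a set"
  assumes P_carrier: "P \<subseteq> carrier G"
    and P_mult: "\<lbrakk>x \<in> P; y \<in> P\<rbrakk> \<Longrightarrow> x \<otimes> y \<in> P"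
    and P_nonempty: "P \<noteq> {}"
begin

abbreviation "S \<equiv> left_inverse_hull G P"
abbreviation "J \<equiv> constructible_ideals G P"
abbreviation "left_translation p \<equiv> {(x, p \<otimes> x) | x. x \<in> P}"

lemma P_carrierD [simp]: "x \<in> P \<Longrightarrow> x \<in> carrier G"
  using P_carrier by auto

lemma P_in_J: "P \<in> J"
  unfolding constructible_ideals_def by (rule UnI1, rule CollectI, rule exI[of _ "[]"]) simp

lemma empty_in_J: "{} \<in> J"
  unfolding constructible_ideals_def by simp

lemma l_coset_empty [simp]: "p <# {} = {}"
  by (simp add: l_coset_def)

lemma preimage_ideal_empty [simp]: "preimage_ideal G P p {} = {}"
  by (simp add: preimage_ideal_def)

lemma J_step:
  assumes "p \<in> P" "q \<in> P" "X \<in> J"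
  shows "preimage_ideal G P p (q <# X) \<in> J"
proof -
  consider "X = {}" | pqs where "set pqs \<subseteq> P \<times> P"
    "X = foldr (\<lambda>(p, q) X. preimage_ideal G P p (q <# X)) pqs P"
    using assms(3) unfolding constructible_ideals_def by auto
  then show ?thesis
  proof cases
    case 1
    then show ?thesis by (simp add: empty_in_J)
  next
    case 2
    then show ?thesis using assms(1,2) unfolding constructible_ideals_def
      by (intro UnI1 CollectI exI[of _ "(p, q) # pqs"]) simp
  qed
qed

text \<open>Hides the word of pairs (p, q) behind the \<open>foldr\<close>. The step also supplies
  \<open>X \<in> J\<close>, so that facts already known for constructible ideals can be applied to
  X.\<close>

lemma J_induct [consumes 1, case_names empty base step]:
  assumes "X \<in> J" "Q {}" "Q P"
    and step: "\<And>p q X. \<lbrakk>p \<in> P; q \<in> P; X \<in> J; Q X\<rbrakk> \<Longrightarrow> Q (preimage_ideal G P p (q <# X))"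
  shows "Q X"
proof -
  have "set pqs \<subseteq> P \<times> P \<Longrightarrow>
      foldr (\<lambda>(p, q) X. preimage_ideal G P p (q <# X)) pqs P \<in> J \<and>
      Q (foldr (\<lambda>(p, q) X. preimage_ideal G P p (q <# X)) pqs P)" for pqs
    by (induction pqs) (auto simp: P_in_J assms(3) intro!: J_step step)
  then show ?thesis using assms(1,2) unfolding constructible_ideals_def by auto
qed

lemma J_subset: "X \<in> J \<Longrightarrow> X \<subseteq> P"
  by (induction rule: J_induct) (auto simp: preimage_ideal_def)

text \<open>If p x = q z with z in X, then p (x y) = q (z y): right multiplication commutes with the
  left operations that build the ideal. This is what later puts (x r)P inside X.\<close>

lemma J_right_ideal: "X \<in> J \<Longrightarrow> x \<in> X \<Longrightarrow> y \<in> P \<Longrightarrow> x \<otimes> y \<in> X"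
proof (induction arbitrary: x rule: J_induct)
  case (step p q X)
  then obtain z where z: "z \<in> X" "p \<otimes> x = q \<otimes> z" "x \<in> P"
    by (auto simp: preimage_ideal_def l_coset_def)
  have "z \<in> P" using z(1) J_subset[OF step(3)] by auto
  then have "p \<otimes> (x \<otimes> y) = q \<otimes> (z \<otimes> y)"
    using z step by (metis P_carrierD m_assoc)
  then show ?case
    using z step P_mult by (auto simp: preimage_ideal_def l_coset_def)
qed (auto simp: P_mult)

text \<open>As \<open>P\<close> need not contain the identity, the missing factor is supplied by \<open>p\<close> itself.\<close>

lemma J_l_coset:
  assumes "p \<in> P" "X \<in> J"
  shows "p <# X \<in> J"
proof -
  have "preimage_ideal G P p ((p \<otimes> p) <# X) = p <# X"
    using assms J_subset[OF assms(2)] P_mult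
    by (auto simp: preimage_ideal_def l_coset_def m_assoc subset_iff)
  then show ?thesis using J_step[OF assms(1) P_mult[OF assms(1,1)] assms(2)] by simp
qed

lemma J_preimage:
  assumes "p \<in> P" "X \<in> J"
  shows "preimage_ideal G P p X \<in> J"
proof -
  have "preimage_ideal G P (p \<otimes> p) (p <# X) = preimage_ideal G P p X"
    using assms J_subset[OF assms(2)] P_mult
    by (auto simp: preimage_ideal_def l_coset_def m_assoc subset_iff)
  then show ?thesis using J_step[OF P_mult[OF assms(1,1)] assms] by simp
qed

section \<open>Constructible ideals under the partial bijections of the hull\<close>

lemma left_translation_Image: "X \<subseteq> P \<Longrightarrow> left_translation p `` X = p <# X"
  by (auto simp: l_coset_def)

lemma left_translation_converse_Image: "(left_translation p)\<inverse> `` X = preimage_ideal G P p X"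
  by (auto simp: preimage_ideal_def)

text \<open>Images and preimages go through one induction because the case \<open>inv\<close>
  exchanges them.\<close>

lemma J_Image: "s \<in> S \<Longrightarrow> X \<in> J \<Longrightarrow> s `` X \<in> J \<and> s\<inverse> `` X \<in> J"
proof (induction arbitrary: X rule: left_inverse_hull.induct)
  case (gen p)
  then show ?case
    using J_l_coset[OF gen] J_preimage[OF gen]
    by (simp only: left_translation_Image[OF J_subset] left_translation_converse_Image)
next
  case (comp s t)
  then show ?case by (simp add: relcomp_Image converse_relcomp)
qed (auto simp: empty_in_J)

text \<open>Composition multiplies and \<open>converse\<close> inverts the group element, so each
  member of the hull is cut out of a single left translation. Containment in P is carried along
  because cancellation needs points of the group; for the empty relation g is arbitrary.\<close>

lemma hull_translation:
  "s \<in> S \<Longrightarrow> \<exists>g\<in>carrier G. \<forall>(x, y)\<in>s. x \<in> P \<and> y \<in> P \<and> y = g \<otimes> x"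
proof (induction rule: left_inverse_hull.induct)
  case (gen p)
  then show ?case by (intro bexI[of _ p]) (auto simp: P_mult)
next
  case (comp s t)
  then obtain g h where "g \<in> carrier G" "h \<in> carrier G"
    "\<forall>(x, y)\<in>s. x \<in> P \<and> y \<in> P \<and> y = g \<otimes> x" "\<forall>(x, y)\<in>t. x \<in> P \<and> y \<in> P \<and> y = h \<otimes> x"
    by blast
  then show ?case by (intro bexI[of _ "g \<otimes> h"]) (fastforce simp: m_assoc)+
next
  case (inv s)
  then obtain g where "g \<in> carrier G" "\<forall>(x, y)\<in>s. x \<in> P \<and> y \<in> P \<and> y = g \<otimes> x"
    by blast
  then show ?case by (intro bexI[of _ "inv g"]) (auto simp: m_assoc[symmetric])
qed auto

lemma hull_subset: "s \<in> S \<Longrightarrow> s \<subseteq> P \<times> P"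
  using hull_translation by fast

lemma Domain_in_J: "s \<in> S \<Longrightarrow> Domain s \<in> J"
proof -
  assume s: "s \<in> S"
  then have "Domain s = s\<inverse> `` P" using hull_subset by auto
  then show ?thesis using J_Image[OF s P_in_J] by simp
qed

lemma Range_in_J: "s \<in> S \<Longrightarrow> Range s \<in> J"
  using Domain_in_J[OF left_inverse_hull.inv] by simp

lemma hull_inj:
  assumes "s \<in> S" "(x, z) \<in> s" "(y, z) \<in> s"
  shows "x = y"
proof -
  obtain g where g: "g \<in> carrier G" "\<forall>(x, y)\<in>s. x \<in> P \<and> y \<in> P \<and> y = g \<otimes> x"
    using hull_translation[OF assms(1)] by blast
  then have "x \<in> carrier G" "y \<in> carrier G" "g \<otimes> x = g \<otimes> y"
    using bspec[OF g(2) assms(2)] bspec[OF g(2) assms(3)] by auto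
  then show ?thesis using g(1) by simp
qed

text \<open>Applying s, then the identity of X, then the converse of s fixes the points that s sends
  into X; injectivity of s excludes any other pair.\<close>

lemma Id_on_converse_Image_in_hull:
  assumes "s \<in> S" "Id_on X \<in> S"
  shows "Id_on (s\<inverse> `` X) \<in> S"
proof -
  have "Id_on (s\<inverse> `` X) = s O Id_on X O s\<inverse>"
    using hull_inj[OF assms(1)] by blast
  moreover have "s O Id_on X O s\<inverse> \<in> S"
    by (intro left_inverse_hull.comp left_inverse_hull.inv assms)
  ultimately show ?thesis by simp
qed

text \<open>Realises the constructible ideals as idempotents of the hull. Closure under intersection
  follows, since intersecting with X is taking the image under its partial identity.\<close>

lemma Id_on_in_hull: "X \<in> J \<Longrightarrow> Id_on X \<in> S"
proof (induction rule: J_induct)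
  case empty
  then show ?case by (simp add: left_inverse_hull.zero)
next
  case base
  obtain p where "p \<in> P" using P_nonempty by auto
  then have p: "left_translation p \<in> S" by (rule left_inverse_hull.gen)
  \<comment> \<open>By injectivity a translation followed by its converse is the identity of its
    domain P, whether or not P contains the unit.\<close>
  have "Id_on P = left_translation p O (left_translation p)\<inverse>"
    using hull_inj[OF p] by blast
  moreover have "left_translation p O (left_translation p)\<inverse> \<in> S"
    by (intro left_inverse_hull.comp left_inverse_hull.inv p)
  ultimately show ?case by simp
next
  case (step p q X)
  \<comment> \<open>This is the map x \<mapsto> q^{-1} p x, chosen because its preimage of X is
    p^{-1} q X.\<close>
  let ?s = "left_translation p O (left_translation q)\<inverse>"
  have "?s \<in> S"
    by (intro left_inverse_hull.comp left_inverse_hull.inv left_inverse_hull.gen step)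
  moreover have "?s\<inverse> `` X = preimage_ideal G P p (q <# X)"
    by (simp only: converse_relcomp converse_converse relcomp_Image
        left_translation_Image[OF J_subset[OF step(3)]] left_translation_converse_Image)
  ultimately show ?case using Id_on_converse_Image_in_hull[OF _ step(4), of ?s] by simp
qed

lemma J_Int: "X \<in> J \<Longrightarrow> Y \<in> J \<Longrightarrow> X \<inter> Y \<in> J"
proof -
  assume "X \<in> J" "Y \<in> J"
  moreover have "X \<inter> Y = Id_on X `` Y" by auto
  ultimately show ?thesis using J_Image[OF Id_on_in_hull] by metis
qed

section \<open>The group element attached to a partial bijection\<close>

lemma translation_part_eqI:
  assumes "s \<in> S" "s \<noteq> {}" "g \<in> carrier G" "\<forall>(x, y)\<in>s. y = g \<otimes> x"
  shows "translation_part G s = g"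
  unfolding translation_part_def
proof (rule the_equality)
  fix h assume h: "h \<in> carrier G \<and> (\<forall>(x, y)\<in>s. y = h \<otimes> x)"
  \<comment> \<open>Cancellation at one point of s already determines the group element.\<close>
  obtain x y where "(x, y) \<in> s" using assms(2) by auto
  then have "x \<in> carrier G" "h \<otimes> x = g \<otimes> x"
    using hull_subset[OF assms(1)] assms(4) h by fastforce+
  then show "h = g" using assms(3) h by simp
qed (use assms in auto)

lemma translation_part_eq_iff:
  assumes "s \<in> S" "s \<noteq> {}"
  shows "translation_part G s = g \<longleftrightarrow> g \<in> carrier G \<and> (\<forall>(x, y)\<in>s. y = g \<otimes> x)"
proof
  obtain h where h: "h \<in> carrier G" "\<forall>(x, y)\<in>s. y = h \<otimes> x"
    using hull_translation[OF assms(1)] by fast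
  then show "translation_part G s = g \<Longrightarrow> g \<in> carrier G \<and> (\<forall>(x, y)\<in>s. y = g \<otimes> x)"
    using translation_part_eqI[OF assms] by blast
qed (use assms translation_part_eqI in blast)

section \<open>Characters and the partial action\<close>

abbreviation "\<Omega> \<equiv> characters G P"

lemma char_extensional: "\<omega> \<in> \<Omega> \<Longrightarrow> \<omega> \<in> J \<rightarrow>\<^sub>E {0, 1}"
  by (simp add: characters_def)

lemma characters_subset: "\<Omega> \<subseteq> (J \<rightarrow>\<^sub>E {0, 1})"
  using char_extensional by blast

lemma char_values: "\<omega> \<in> \<Omega> \<Longrightarrow> X \<in> J \<Longrightarrow> \<omega> X = 0 \<or> \<omega> X = 1"
  using PiE_mem[OF char_extensional] by blast

lemma char_Int: "\<omega> \<in> \<Omega> \<Longrightarrow> X \<in> J \<Longrightarrow> Y \<in> J \<Longrightarrow> \<omega> (X \<inter> Y) = \<omega> X * \<omega> Y"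
  by (simp add: characters_def)

lemma char_empty: "\<omega> \<in> \<Omega> \<Longrightarrow> \<omega> {} = 0"
  by (simp add: characters_def)

lemma char_mono: "\<omega> \<in> \<Omega> \<Longrightarrow> X \<in> J \<Longrightarrow> Y \<in> J \<Longrightarrow> X \<subseteq> Y \<Longrightarrow> \<omega> X = 1 \<Longrightarrow> \<omega> Y = 1"
  using char_Int[of \<omega> X Y] by (simp add: Int_absorb2)

lemma char_P: "\<omega> \<in> \<Omega> \<Longrightarrow> \<omega> P = 1"
proof -
  assume \<omega>: "\<omega> \<in> \<Omega>"
  then obtain X where "X \<in> J" "\<omega> X \<noteq> 0" by (auto simp: characters_def)
  then show ?thesis
    using char_mono[OF \<omega> _ P_in_J] J_subset char_values[OF \<omega> \<open>X \<in> J\<close>] by simp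
qed

lemma charI:
  assumes "\<omega> \<in> J \<rightarrow>\<^sub>E {0, 1}" "\<And>X Y. X \<in> J \<Longrightarrow> Y \<in> J \<Longrightarrow> \<omega> (X \<inter> Y) = \<omega> X * \<omega> Y"
    "\<omega> {} = 0" "X \<in> J" "\<omega> X = 1"
  shows "\<omega> \<in> \<Omega>"
  using assms by (auto simp: characters_def intro!: bexI[of _ X])

lemma char_eqI: "\<omega> \<in> \<Omega> \<Longrightarrow> \<psi> \<in> \<Omega> \<Longrightarrow> (\<And>X. X \<in> J \<Longrightarrow> \<omega> X = \<psi> X) \<Longrightarrow> \<omega> = \<psi>"
  by (rule PiE_ext[OF char_extensional char_extensional])

text \<open>Trades the definite description in \<open>translation_part\<close> for a pointwise
  equation. Nonemptiness of s is absorbed by the value 1 at \<open>Domain s\<close>, since \<omega>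
  is 0 at the empty ideal.\<close>

lemma implements_iff:
  assumes "\<omega> \<in> \<Omega>"
  shows "implements G P g \<omega> s \<longleftrightarrow>
    s \<in> S \<and> g \<in> carrier G \<and> (\<forall>(x, y)\<in>s. y = g \<otimes> x) \<and> \<omega> (Domain s) = 1"
proof -
  have "s \<noteq> {}" if "\<omega> (Domain s) = 1"
    using that char_empty[OF assms] by auto
  then show ?thesis
    unfolding implements_def using translation_part_eq_iff[of s g] by auto
qed

section \<open>Well-definedness and composition of the partial action\<close>

abbreviation act :: "'a \<Rightarrow> ('a set \<Rightarrow> nat) \<Rightarrow> 'a set \<Rightarrow> nat" where
  "act \<equiv> partial_action G P"

lemma action_domain_iff: "\<omega> \<in> action_domain G P g \<longleftrightarrow> \<omega> \<in> \<Omega> \<and> (\<exists>s. implements G P g \<omega> s)"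
  by (simp add: action_domain_def)

text \<open>The choice made by \<open>SOME\<close> does not matter: two relations implementing the
  same g agree wherever both are defined, and cutting a preimage down to the other domain leaves
  \<omega> unchanged because \<omega> is 1 at that domain.\<close>

lemma act_eq:
  assumes \<omega>: "\<omega> \<in> \<Omega>" and s: "implements G P g \<omega> s" and X: "X \<in> J"
  shows "act g \<omega> X = \<omega> (s\<inverse> `` X)"
proof -
  define t where "t = (SOME s. implements G P g \<omega> s)"
  have t: "implements G P g \<omega> t"
    unfolding t_def using s by (rule someI)
  have *: "\<omega> (u\<inverse> `` X) = \<omega> (u\<inverse> `` X \<inter> Domain v)"
    if "implements G P g \<omega> u" "implements G P g \<omega> v" for u v
  proof -
    have "u \<in> S" "v \<in> S" "\<omega> (Domain v) = 1"
      using that \<omega> by (auto simp: implements_iff)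
    then show ?thesis using char_Int[OF \<omega> _ Domain_in_J] J_Image X by simp
  qed
  have "s\<inverse> `` X \<inter> Domain t = t\<inverse> `` X \<inter> Domain s"
    using s t \<omega> by (fastforce simp: implements_iff)
  then have "\<omega> (s\<inverse> `` X) = \<omega> (t\<inverse> `` X)"
    using *[OF s t] *[OF t s] by simp
  moreover have "t\<inverse> `` (X \<inter> Range t) = t\<inverse> `` X" by auto
  ultimately show ?thesis
    using X by (simp add: partial_action_def Let_def flip: t_def)
qed

lemma act_in_characters:
  assumes \<omega>: "\<omega> \<in> \<Omega>" and s: "implements G P g \<omega> s"
  shows "act g \<omega> \<in> \<Omega>"
proof (rule charI)
  have S: "s \<in> S" and D: "\<omega> (Domain s) = 1" and g: "\<forall>(x, y)\<in>s. y = g \<otimes> x"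
    using s \<omega> by (auto simp: implements_iff)
  show "act g \<omega> \<in> J \<rightarrow>\<^sub>E {0, 1}"
  proof (rule PiE_I)
    show "act g \<omega> X \<in> {0, 1}" if "X \<in> J" for X
      using that act_eq[OF \<omega> s that] J_Image[OF S that] char_values[OF \<omega>] by simp
    show "act g \<omega> X = undefined" if "X \<notin> J" for X
      using that by (simp add: partial_action_def Let_def)
  qed
  show "act g \<omega> (X \<inter> Y) = act g \<omega> X * act g \<omega> Y" if "X \<in> J" "Y \<in> J" for X Y
  proof -
    \<comment> \<open>As part of a translation s is single-valued, so taking preimages commutes with
      intersection.\<close>
    have "s\<inverse> `` (X \<inter> Y) = s\<inverse> `` X \<inter> s\<inverse> `` Y"
      using g by fastforce
    then show ?thesis using that J_Int act_eq[OF \<omega> s] J_Image[OF S] char_Int[OF \<omega>] by simp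
  qed
  show "act g \<omega> {} = 0"
    using act_eq[OF \<omega> s empty_in_J] char_empty[OF \<omega>] by simp
  \<comment> \<open>The image of s witnesses that the translate is nonzero: its preimage is the
    domain of s, where \<omega> is 1.\<close>
  show "Range s \<in> J" using Range_in_J[OF S] .
  have "s\<inverse> `` Range s = Domain s" by auto
  then show "act g \<omega> (Range s) = 1"
    using act_eq[OF \<omega> s Range_in_J[OF S]] D by simp
qed

lemma implements_converse:
  assumes \<omega>: "\<omega> \<in> \<Omega>" and s: "implements G P g \<omega> s"
  shows "implements G P (inv g) (act g \<omega>) (s\<inverse>)"
proof -
  have S: "s \<in> S" "\<omega> (Domain s) = 1" "g \<in> carrier G" "\<forall>(x, y)\<in>s. y = g \<otimes> x"
    using s \<omega> by (auto simp: implements_iff)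
  have "x = inv g \<otimes> y" if "(x, y) \<in> s" for x y
  proof -
    have "x \<in> carrier G" using that hull_subset[OF S(1)] by auto
    then show ?thesis using that S by (auto simp: m_assoc[symmetric])
  qed
  moreover have "s\<inverse> `` Range s = Domain s" by auto
  ultimately show ?thesis
    using S left_inverse_hull.inv[OF S(1)] act_eq[OF \<omega> s Range_in_J[OF S(1)]]
    by (auto simp: implements_iff[OF act_in_characters[OF \<omega> s]])
qed

text \<open>\<open>s O t\<close> applies s before t, and its domain is the preimage of
  \<open>Domain t\<close> under s. So the condition on \<open>act h \<omega>\<close> at
  \<open>Domain t\<close> is the condition on \<omega> at the domain of the composite.\<close>

lemma implements_comp:
  assumes \<omega>: "\<omega> \<in> \<Omega>" and s: "implements G P h \<omega> s" and t: "implements G P g (act h \<omega>) t"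
  shows "implements G P (g \<otimes> h) \<omega> (s O t)"
proof -
  have s': "s \<in> S" "h \<in> carrier G" "\<And>x y. (x, y) \<in> s \<Longrightarrow> y = h \<otimes> x"
    using s by (auto simp: implements_iff[OF \<omega>])
  have t': "t \<in> S" "g \<in> carrier G" "\<And>x y. (x, y) \<in> t \<Longrightarrow> y = g \<otimes> x" "act h \<omega> (Domain t) = 1"
    using t by (auto simp: implements_iff[OF act_in_characters[OF \<omega> s]])
  have "Domain (s O t) = s\<inverse> `` Domain t" by blast
  then have "\<omega> (Domain (s O t)) = 1"
    using act_eq[OF \<omega> s Domain_in_J[OF t'(1)]] t'(4) by simp
  moreover have "z = g \<otimes> h \<otimes> x" if "(x, y) \<in> s" "(y, z) \<in> t" for x y z
  proof -
    have "x \<in> carrier G" using that s' hull_subset[of s] by auto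
    then show ?thesis using s'(2) t'(2) by (simp add: s'(3)[OF that(1)] t'(3)[OF that(2)] m_assoc)
  qed
  moreover have "s O t \<in> S" using s'(1) t'(1) by (rule left_inverse_hull.comp[rotated])
  ultimately show ?thesis
    unfolding implements_iff[OF \<omega>] using s'(2) t'(2) by blast
qed

lemma implements_one: "\<omega> \<in> \<Omega> \<Longrightarrow> implements G P \<one> \<omega> (Id_on P)"
  using Id_on_in_hull[OF P_in_J] char_P by (auto simp: implements_iff)

text \<open>Since every implementing relation computes the action, the composite of s and t may be
  used for the product of the group elements.\<close>

lemma act_comp:
  assumes \<omega>: "\<omega> \<in> \<Omega>" and s: "implements G P h \<omega> s" and t: "implements G P g (act h \<omega>) t"
  shows "act g (act h \<omega>) = act (g \<otimes> h) \<omega>"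
proof (rule char_eqI)
  note \<psi> = act_in_characters[OF \<omega> s]
  note c = implements_comp[OF assms]
  show "act g (act h \<omega>) \<in> \<Omega>" using act_in_characters[OF \<psi> t] .
  show "act (g \<otimes> h) \<omega> \<in> \<Omega>" using act_in_characters[OF \<omega> c] .
  fix X assume X: "X \<in> J"
  have "t \<in> S" using t \<psi> by (simp add: implements_iff)
  have "act g (act h \<omega>) X = act h \<omega> (t\<inverse> `` X)"
    using act_eq[OF \<psi> t X] .
  also have "\<dots> = \<omega> (s\<inverse> `` (t\<inverse> `` X))"
    using act_eq[OF \<omega> s] J_Image[OF \<open>t \<in> S\<close> X] by simp
  also have "\<dots> = act (g \<otimes> h) \<omega> X"
    using act_eq[OF \<omega> c X] by (simp add: converse_relcomp relcomp_Image)
  finally show "act g (act h \<omega>) X = act (g \<otimes> h) \<omega> X" .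
qed

lemma act_one: "\<omega> \<in> \<Omega> \<Longrightarrow> act \<one> \<omega> = \<omega>"
proof (rule char_eqI)
  assume \<omega>: "\<omega> \<in> \<Omega>"
  show "act \<one> \<omega> \<in> \<Omega>" using act_in_characters[OF \<omega> implements_one[OF \<omega>]] .
  fix X assume X: "X \<in> J"
  then have "(Id_on P)\<inverse> `` X = X" using J_subset by auto
  then show "act \<one> \<omega> X = \<omega> X" using act_eq[OF \<omega> implements_one[OF \<omega>] X] by simp
qed

lemma act_inv:
  assumes \<omega>: "\<omega> \<in> \<Omega>" and s: "implements G P g \<omega> s"
  shows "act (inv g) (act g \<omega>) = \<omega>"
proof -
  have "g \<in> carrier G" using s \<omega> by (simp add: implements_iff)
  then show ?thesis
    using act_comp[OF \<omega> s implements_converse[OF \<omega> s]] act_one[OF \<omega>] by simp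
qed

section \<open>The boundary\<close>

abbreviation "B \<equiv> boundary G P"
abbreviation "BT \<equiv> subtopology (character_space G P) B"

lemma topspace_character_space [simp]: "topspace (character_space G P) = \<Omega>"
  using characters_subset by (simp add: character_space_def Int_absorb1)

lemma B_subset: "B \<subseteq> \<Omega>"
  unfolding boundary_def using closure_of_subset_topspace topspace_character_space by metis

lemma B_char [simp]: "\<omega> \<in> B \<Longrightarrow> \<omega> \<in> \<Omega>"
  using B_subset by auto

lemma characters_Int_B [simp]: "\<Omega> \<inter> B = B"
  using B_subset by auto

lemma topspace_BT: "topspace BT = B"
  by simp

lemma openin_character_space:
  "openin (character_space G P) A \<longleftrightarrow> A \<subseteq> \<Omega> \<and>
    (\<forall>\<omega>\<in>A. \<exists>F. finite F \<and> F \<subseteq> J \<and> (\<forall>\<psi>\<in>\<Omega>. (\<forall>X\<in>F. \<psi> X = \<omega> X) \<longrightarrow> \<psi> \<in> A))"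
proof -
  have "\<Omega> \<inter> (J \<rightarrow>\<^sub>E {0, 1}) = \<Omega>" using characters_subset by blast
  then show ?thesis
    unfolding character_space_def openin_subtopology_product_discrete by simp
qed

lemma openin_BT:
  "openin BT A \<longleftrightarrow> A \<subseteq> B \<and>
    (\<forall>\<omega>\<in>A. \<exists>F. finite F \<and> F \<subseteq> J \<and> (\<forall>\<psi>\<in>B. (\<forall>X\<in>F. \<psi> X = \<omega> X) \<longrightarrow> \<psi> \<in> A))"
proof -
  have *: "\<Omega> \<inter> B = B" using B_subset by auto
  have "B \<inter> (J \<rightarrow>\<^sub>E {0, 1}) = B" using B_subset characters_subset by blast
  then show ?thesis
    unfolding character_space_def subtopology_subtopology * openin_subtopology_product_discrete
    by simp
qed

lemma openin_BT_coordinate: "X \<in> J \<Longrightarrow> openin BT {\<omega> \<in> B. \<omega> X = i}"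
  unfolding openin_BT by (auto intro!: exI[of _ "{X}"])

text \<open>Each condition on a character involves at most three coordinates, so its failure is an
  open condition and the characters are closed in a compact product. Being nonzero somewhere is not
  visibly of this kind; it is replaced by the value 1 at P, equivalent to it in the presence of
  multiplicativity.\<close>

lemma compact_character_space: "compact_space (character_space G P)"
proof -
  let ?T = "product_topology (\<lambda>_. discrete_topology {0, 1::nat}) J"
  \<comment> \<open>Viewing the product as its subspace \<open>UNIV\<close> brings it under the
    coordinate criterion for open sets.\<close>
  have "openin (subtopology ?T UNIV) ((J \<rightarrow>\<^sub>E {0, 1}) - \<Omega>)"
    unfolding openin_subtopology_product_discrete
  proof (intro conjI ballI)
    fix \<omega> assume \<omega>: "\<omega> \<in> (J \<rightarrow>\<^sub>E {0, 1}) - \<Omega>"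
    then consider X Y where "X \<in> J" "Y \<in> J" "\<omega> (X \<inter> Y) \<noteq> \<omega> X * \<omega> Y"
      | "\<omega> {} \<noteq> 0" | "\<omega> P \<noteq> 1"
      using charI[OF _ _ _ P_in_J, of \<omega>] by fast
    then show "\<exists>F. finite F \<and> F \<subseteq> J \<and>
      (\<forall>h\<in>UNIV \<inter> (J \<rightarrow>\<^sub>E {0, 1}). (\<forall>i\<in>F. h i = \<omega> i) \<longrightarrow> h \<in> (J \<rightarrow>\<^sub>E {0, 1}) - \<Omega>)"
    proof cases
      case 1
      then show ?thesis
        using char_Int J_Int by (intro exI[of _ "{X, Y, X \<inter> Y}"]) force
    next
      case 2
      then show ?thesis using char_empty empty_in_J by (intro exI[of _ "{{}}"]) force
    next
      case 3
      then show ?thesis using char_P P_in_J by (intro exI[of _ "{P}"]) force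
    qed
  qed auto
  then have "closedin ?T \<Omega>"
    using characters_subset by (simp add: closedin_def)
  moreover have "compact_space ?T"
    by (simp add: compact_space_product_topology compact_space_discrete_topology)
  ultimately show ?thesis
    unfolding character_space_def
    by (simp add: closedin_compact_space compact_space_subtopology)
qed

lemma compact_BT: "compact_space BT"
  unfolding boundary_def
  by (rule compact_space_subtopology[OF closedin_compact_space[OF compact_character_space
      closedin_closure_of]])

lemma Hausdorff_BT: "Hausdorff_space BT"
  unfolding character_space_def
  by (intro Hausdorff_space_subtopology iffD2[OF Hausdorff_space_product_topology]
      disjI2 ballI Hausdorff_space_discrete_topology)

text \<open>Two characters of C that differ at X lie in the disjoint open sets given by the values 0
  and 1 at X, and these sets cover C.\<close>

lemma totally_disconnected_BT: "totally_disconnected_top BT"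
  unfolding totally_disconnected_top_def
proof (intro allI impI ballI)
  fix C \<omega> \<psi> assume C: "connectedin BT C" "\<omega> \<in> C" "\<psi> \<in> C"
  have sub: "C \<subseteq> B" using connectedin_subset_topspace[OF C(1)] by simp
  show "\<omega> = \<psi>"
  proof (rule char_eqI)
    fix X assume X: "X \<in> J"
    show "\<omega> X = \<psi> X"
    proof (rule ccontr)
      assume ne: "\<omega> X \<noteq> \<psi> X"
      let ?U = "\<lambda>i. {\<omega> \<in> B. \<omega> X = i}"
      have v: "\<phi> X = 0 \<or> \<phi> X = 1" if "\<phi> \<in> C" for \<phi>
        using that sub char_values[OF B_char X] by blast
      then have "C \<subseteq> ?U 0 \<union> ?U 1" using sub by blast
      moreover have "?U 0 \<inter> C \<noteq> {}" "?U 1 \<inter> C \<noteq> {}"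
        using ne v[OF C(2)] v[OF C(3)] C(2,3) sub by (auto simp: disjoint_iff)
      moreover have "?U 0 \<inter> ?U 1 \<inter> C = {}" by auto
      moreover have "openin BT (?U 0)" "openin BT (?U 1)"
        by (rule openin_BT_coordinate[OF X])+
      ultimately have "\<exists>E1 E2. openin BT E1 \<and> openin BT E2 \<and> C \<subseteq> E1 \<union> E2 \<and>
          E1 \<inter> E2 \<inter> C = {} \<and> E1 \<inter> C \<noteq> {} \<and> E2 \<inter> C \<noteq> {}"
        by (intro exI[of _ "?U 0"] exI[of _ "?U 1"] conjI)
      then show False
        using C(1) unfolding connectedin by (elim conjE) (rule notE)
    qed
  qed (use sub C in auto)
qed

section \<open>Invariance of the boundary under the partial action\<close>

lemma act_maximal:
  assumes \<omega>: "\<omega> \<in> maximal_characters G P" and s: "implements G P g \<omega> s"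
  shows "act g \<omega> \<in> maximal_characters G P"
proof -
  have \<omega>': "\<omega> \<in> \<Omega>" using \<omega> by (simp add: maximal_characters_def)
  note chi = act_in_characters[OF \<omega>' s]
  note s' = implements_converse[OF \<omega>' s]
  have S: "s \<in> S" "g \<in> carrier G" using s \<omega>' by (auto simp: implements_iff)
  \<comment> \<open>A character above the translate is moved back by g^{-1}. There it lies above
    \<omega>, so maximality makes the filters equal, and moving forward again carries the equality
    over.\<close>
  have "char_filter G P (act g \<omega>) = char_filter G P \<psi>"
    if \<psi>: "\<psi> \<in> \<Omega>" and le: "char_filter G P (act g \<omega>) \<subseteq> char_filter G P \<psi>" for \<psi>
  proof -
    \<comment> \<open>The filter of the translate contains the image of s, hence so does the larger
      filter; this puts \<psi> in the domain of g^{-1}.\<close>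
    have "\<psi> (Range s) = 1"
      using le s' Range_in_J[OF S(1)] by (auto simp: char_filter_def implements_iff[OF chi])
    then have i: "implements G P (inv g) \<psi> (s\<inverse>)"
      using s' by (simp add: implements_iff[OF chi] implements_iff[OF \<psi>])
    have "char_filter G P \<omega> \<subseteq> char_filter G P (act (inv g) \<psi>)"
    proof
      fix X assume X: "X \<in> char_filter G P \<omega>"
      then have "X \<in> J" "act (inv g) (act g \<omega>) X = 1"
        by (auto simp: char_filter_def act_inv[OF \<omega>' s])
      then show "X \<in> char_filter G P (act (inv g) \<psi>)"
        using le J_Image[OF S(1)] by (auto simp: char_filter_def act_eq[OF chi s'] act_eq[OF \<psi> i])
    qed
    then have eq: "char_filter G P \<omega> = char_filter G P (act (inv g) \<psi>)"
      using \<omega> act_in_characters[OF \<psi> i] by (auto simp: maximal_characters_def)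
    have "X \<in> char_filter G P (act g \<omega>)" if X: "X \<in> char_filter G P \<psi>" for X
    proof -
      note j = implements_converse[OF \<psi> i]
      have "X \<in> J" "act g (act (inv g) \<psi>) X = 1"
        using X act_inv[OF \<psi> i] S by (auto simp: char_filter_def)
      then show ?thesis
        using eq J_Image[OF S(1)] act_eq[OF act_in_characters[OF \<psi> i] j] act_eq[OF \<omega>' s] S
        by (auto simp: char_filter_def)
    qed
    then show ?thesis using le by auto
  qed
  then show ?thesis using chi by (simp add: maximal_characters_def)
qed

lemma openin_character_space_cylinder:
  assumes "openin (character_space G P) W" "\<omega> \<in> W"
  obtains F where "finite F" "F \<subseteq> J" "\<forall>\<psi>\<in>\<Omega>. (\<forall>X\<in>F. \<psi> X = \<omega> X) \<longrightarrow> \<psi> \<in> W"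
  using assms unfolding openin_character_space by blast

lemma openin_cylinder:
  "finite F \<Longrightarrow> F \<subseteq> J \<Longrightarrow> openin (character_space G P) {\<psi> \<in> \<Omega>. \<forall>X\<in>F. \<psi> X = \<omega> X}"
  unfolding openin_character_space
  by (intro conjI ballI exI[of _ F]) auto

lemma openin_BT_cylinder:
  "finite F \<Longrightarrow> F \<subseteq> J \<Longrightarrow> openin BT {\<psi> \<in> B. \<forall>X\<in>F. \<psi> X = \<omega> X}"
  unfolding openin_BT
  by (intro conjI ballI exI[of _ F]) auto

text \<open>One s serves a whole neighbourhood: fixing the value at \<open>Domain s\<close> keeps it
  implementing g, and fixing the values at the preimages of the members of F fixes the translate on
  F.\<close>

lemma act_cylinder:
  assumes \<omega>: "\<omega> \<in> \<Omega>" and s: "implements G P g \<omega> s" and F: "finite F" "F \<subseteq> J"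
  obtains F' where "finite F'" "F' \<subseteq> J"
    "\<forall>\<psi>\<in>\<Omega>. (\<forall>X\<in>F'. \<psi> X = \<omega> X) \<longrightarrow>
      implements G P g \<psi> s \<and> (\<forall>X\<in>F. act g \<psi> X = act g \<omega> X)"
proof (rule that[of "insert (Domain s) ((\<lambda>X. s\<inverse> `` X) ` F)"])
  have S: "s \<in> S" "\<omega> (Domain s) = 1" using s \<omega> by (auto simp: implements_iff)
  show "finite (insert (Domain s) ((\<lambda>X. s\<inverse> `` X) ` F))" using F by simp
  show "insert (Domain s) ((\<lambda>X. s\<inverse> `` X) ` F) \<subseteq> J"
    using F(2) J_Image[OF S(1)] Domain_in_J[OF S(1)] by auto
  show "\<forall>\<psi>\<in>\<Omega>. (\<forall>X\<in>insert (Domain s) ((\<lambda>X. s\<inverse> `` X) ` F). \<psi> X = \<omega> X) \<longrightarrow>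
      implements G P g \<psi> s \<and> (\<forall>X\<in>F. act g \<psi> X = act g \<omega> X)"
  proof (intro ballI impI)
    fix \<psi> assume \<psi>: "\<psi> \<in> \<Omega>" "\<forall>X\<in>insert (Domain s) ((\<lambda>X. s\<inverse> `` X) ` F). \<psi> X = \<omega> X"
    then have i: "implements G P g \<psi> s"
      using s S(2) by (simp add: implements_iff[OF \<omega>] implements_iff[OF \<psi>(1)])
    have "act g \<psi> X = act g \<omega> X" if "X \<in> F" for X
      using act_eq[OF \<psi>(1) i, of X] act_eq[OF \<omega> s, of X] that F(2) \<psi>(2) by auto
    then show "implements G P g \<psi> s \<and> (\<forall>X\<in>F. act g \<psi> X = act g \<omega> X)"
      using i by simp
  qed
qed

text \<open>A neighbourhood T of the translate pulls back to a neighbourhood of \<omega>. That one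
  contains a maximal character, whose translate is again maximal and lies in T.\<close>

lemma act_boundary:
  assumes \<omega>: "\<omega> \<in> B" and s: "implements G P g \<omega> s"
  shows "act g \<omega> \<in> B"
  unfolding boundary_def in_closure_of
proof (intro conjI allI impI)
  have \<omega>': "\<omega> \<in> \<Omega>" using \<omega> by simp
  show "act g \<omega> \<in> topspace (character_space G P)"
    using act_in_characters[OF \<omega>' s] topspace_character_space by simp
  fix T assume T: "act g \<omega> \<in> T \<and> openin (character_space G P) T"
  then obtain F where F: "finite F" "F \<subseteq> J"
    "\<forall>\<psi>\<in>\<Omega>. (\<forall>X\<in>F. \<psi> X = act g \<omega> X) \<longrightarrow> \<psi> \<in> T"
    using openin_character_space_cylinder by blast
  obtain F' where F': "finite F'" "F' \<subseteq> J"
    "\<forall>\<psi>\<in>\<Omega>. (\<forall>X\<in>F'. \<psi> X = \<omega> X) \<longrightarrow>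
      implements G P g \<psi> s \<and> (\<forall>X\<in>F. act g \<psi> X = act g \<omega> X)"
    using act_cylinder[OF \<omega>' s F(1,2)] .
  let ?W = "{\<psi> \<in> \<Omega>. \<forall>X\<in>F'. \<psi> X = \<omega> X}"
  have W: "openin (character_space G P) ?W" "\<omega> \<in> ?W"
    using openin_cylinder[OF F'(1,2)] \<omega>' by auto
  have "\<forall>T. \<omega> \<in> T \<and> openin (character_space G P) T \<longrightarrow>
      (\<exists>y. y \<in> maximal_characters G P \<and> y \<in> T)"
    using \<omega> unfolding boundary_def in_closure_of by (rule conjunct2)
  from this[rule_format, OF conjI[OF W(2,1)]]
  obtain \<psi> where \<psi>: "\<psi> \<in> maximal_characters G P" "\<psi> \<in> ?W"
    by (elim exE conjE)
  then have j: "implements G P g \<psi> s" "\<forall>X\<in>F. act g \<psi> X = act g \<omega> X" "\<psi> \<in> \<Omega>"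
    using F'(3) by auto
  then have "act g \<psi> \<in> T" using F(3) act_in_characters by simp
  then show "\<exists>y. y \<in> maximal_characters G P \<and> y \<in> T"
    using act_maximal[OF \<psi>(1) j(1)] by blast
qed

section \<open>Neighbourhoods of maximal characters\<close>

lemma maximal_separation:
  assumes \<omega>: "\<omega> \<in> maximal_characters G P" and Y: "Y \<in> J" "\<omega> Y = 0"
  shows "\<exists>X\<in>J. \<omega> X = 1 \<and> X \<inter> Y = {}"
proof (rule ccontr)
  assume ne: "\<not> ?thesis"
  have \<omega>': "\<omega> \<in> \<Omega>" using \<omega> by (simp add: maximal_characters_def)
  \<comment> \<open>\<open>\<psi>\<close> is the character of the filter generated by the filter of \<open>\<omega>\<close> and \<open>Y\<close>.\<close>
  define Q where "Q Z \<longleftrightarrow> (\<exists>X\<in>J. \<omega> X = 1 \<and> X \<inter> Y \<subseteq> Z)" for Z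
  define \<psi> where "\<psi> = restrict (\<lambda>Z. if Q Z then 1 else 0::nat) J"
  have QI: "Q (Z \<inter> Z') \<longleftrightarrow> Q Z \<and> Q Z'" for Z Z'
  proof
    assume "Q Z \<and> Q Z'"
    then obtain X X' where "X \<in> J" "X' \<in> J" "\<omega> X = 1" "\<omega> X' = 1" "X \<inter> Y \<subseteq> Z" "X' \<inter> Y \<subseteq> Z'"
      by (auto simp: Q_def)
    then show "Q (Z \<inter> Z')"
      unfolding Q_def using J_Int char_Int[OF \<omega>'] by (intro bexI[of _ "X \<inter> X'"]) auto
  qed (auto simp: Q_def)
  have QY: "Q Y" unfolding Q_def using P_in_J char_P[OF \<omega>'] by auto
  have "\<psi> \<in> \<Omega>"
  proof (rule charI[where X = Y])
    show "\<psi> (X \<inter> Z) = \<psi> X * \<psi> Z" if "X \<in> J" "Z \<in> J" for X Z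
      using that J_Int by (simp add: \<psi>_def QI)
    \<comment> \<open>The negated claim enters here: no ideal in the filter of \<omega> misses Y, so
      the generated filter avoids the empty ideal.\<close>
    show "\<psi> {} = 0" using ne by (auto simp: \<psi>_def Q_def empty_in_J)
  qed (use QY Y in \<open>auto simp: \<psi>_def\<close>)
  moreover have "char_filter G P \<omega> \<subseteq> char_filter G P \<psi>"
    by (auto simp: char_filter_def \<psi>_def Q_def)
  ultimately have "char_filter G P \<omega> = char_filter G P \<psi>"
    using \<omega> by (simp add: maximal_characters_def)
  moreover have "Y \<in> char_filter G P \<psi>" using QY Y by (simp add: char_filter_def \<psi>_def)
  ultimately have "Y \<in> char_filter G P \<omega>" by simp
  then show False using Y by (simp add: char_filter_def)
qed

text \<open>One ideal per coordinate is intersected: Y itself if \<omega> is 1 at Y, otherwise an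
  ideal disjoint from Y. Negative conditions become positive ones, which a single ideal can
  express.\<close>

lemma maximal_neighbourhood:
  assumes \<omega>: "\<omega> \<in> maximal_characters G P" and "finite F" "F \<subseteq> J"
  shows "\<exists>X\<in>J. \<omega> X = 1 \<and> (\<forall>\<psi>\<in>\<Omega>. \<psi> X = 1 \<longrightarrow> (\<forall>Y\<in>F. \<psi> Y = \<omega> Y))"
  using assms(2,3)
proof (induction F)
  case empty
  then show ?case using P_in_J char_P \<omega> by (auto simp: maximal_characters_def)
next
  case (insert Y F)
  have \<omega>': "\<omega> \<in> \<Omega>" using \<omega> by (simp add: maximal_characters_def)
  obtain X where X: "X \<in> J" "\<omega> X = 1" "\<forall>\<psi>\<in>\<Omega>. \<psi> X = 1 \<longrightarrow> (\<forall>Y\<in>F. \<psi> Y = \<omega> Y)"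
    using insert by auto
  obtain Z where Z: "Z \<in> J" "\<omega> Z = 1" "\<forall>\<psi>\<in>\<Omega>. \<psi> Z = 1 \<longrightarrow> \<psi> Y = \<omega> Y"
  proof (cases "\<omega> Y = 1")
    case True
    then show ?thesis using that insert by auto
  next
    case False
    then have Y: "Y \<in> J" "\<omega> Y = 0" using insert char_values[OF \<omega>'] by auto
    then obtain Z where Z: "Z \<in> J" "\<omega> Z = 1" "Z \<inter> Y = {}"
      using maximal_separation[OF \<omega>] by blast
    have "\<psi> Y = \<omega> Y" if "\<psi> \<in> \<Omega>" "\<psi> Z = 1" for \<psi>
      using char_Int[OF that(1) Z(1) Y(1)] that char_empty[OF that(1)] Z Y by simp
    then show ?thesis using that Z by auto
  qed
  have "\<forall>\<psi>\<in>\<Omega>. \<psi> (X \<inter> Z) = 1 \<longrightarrow> (\<forall>Y\<in>insert Y F. \<psi> Y = \<omega> Y)"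
    using X Z char_mono[OF _ J_Int[OF X(1) Z(1)]] by blast
  moreover have "\<omega> (X \<inter> Z) = 1" using char_Int[OF \<omega>'] X Z by simp
  ultimately show ?case using J_Int[OF X(1) Z(1)] by blast
qed

lemma openin_BT_contains_ideal:
  assumes A: "openin BT A" "A \<noteq> {}"
  shows "\<exists>X\<in>J. X \<noteq> {} \<and> (\<forall>\<psi>\<in>B. \<psi> X = 1 \<longrightarrow> \<psi> \<in> A)"
proof -
  \<comment> \<open>The boundary is a closure in the full character space, so A is lifted to an open
    set there before density is used.\<close>
  obtain W where W: "openin (character_space G P) W" "A = W \<inter> B"
    using A(1) by (auto simp: openin_subtopology)
  obtain \<xi> where "\<xi> \<in> W" "\<xi> \<in> character_space G P closure_of maximal_characters G P"
    using A(2) W(2) by (auto simp: boundary_def)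
  then obtain \<omega> where \<omega>: "\<omega> \<in> maximal_characters G P" "\<omega> \<in> W"
    using W(1) unfolding in_closure_of by blast
  then have \<omega>': "\<omega> \<in> \<Omega>" by (simp add: maximal_characters_def)
  obtain F where F: "finite F" "F \<subseteq> J" "\<forall>\<psi>\<in>\<Omega>. (\<forall>X\<in>F. \<psi> X = \<omega> X) \<longrightarrow> \<psi> \<in> W"
    using openin_character_space_cylinder[OF W(1) \<omega>(2)] .
  obtain X where "X \<in> J" "\<omega> X = 1" "\<forall>\<psi>\<in>\<Omega>. \<psi> X = 1 \<longrightarrow> (\<forall>Y\<in>F. \<psi> Y = \<omega> Y)"
    using maximal_neighbourhood[OF \<omega>(1) F(1,2)] by blast
  then show ?thesis
    using F(3) W(2) char_empty[OF \<omega>'] by (intro bexI[of _ X]) auto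
qed

section \<open>The transformation groupoid\<close>

abbreviation "\<G> \<equiv> boundary_groupoid G P"
abbreviation "AT \<equiv> arrows \<G>"

lemma groupoid_simps [simp]:
  "units \<G> = BT" "src \<G> = snd" "rng \<G> (g, \<omega>) = act g \<omega>" "ident \<G> \<omega> = (\<one>, \<omega>)"
  "gmult \<G> (g, \<omega>) (h, \<psi>) = (g \<otimes> h, \<psi>)" "ginv \<G> (g, \<omega>) = (inv g, act g \<omega>)"
  by (auto simp: boundary_groupoid_def)

lemma AT_eq:
  "AT = subtopology (prod_topology (discrete_topology (carrier G)) BT)
     {(g, \<omega>). g \<in> carrier G \<and> \<omega> \<in> B \<and> \<omega> \<in> action_domain G P g}"
  by (simp add: boundary_groupoid_def)

lemma arrow_iff: "(g, \<omega>) \<in> topspace AT \<longleftrightarrow> \<omega> \<in> B \<and> (\<exists>s. implements G P g \<omega> s)"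
proof -
  have "g \<in> carrier G" if "\<omega> \<in> B" "implements G P g \<omega> s" for s
    using that by (simp add: implements_iff)
  then show ?thesis
    unfolding AT_eq topspace_subtopology topspace_prod_topology topspace_BT
    by (auto simp: action_domain_iff)
qed

lemma arrow_cases:
  assumes "a \<in> topspace AT"
  obtains g \<omega> s where "a = (g, \<omega>)" "g \<in> carrier G" "\<omega> \<in> B" "\<omega> \<in> \<Omega>" "implements G P g \<omega> s"
proof -
  obtain g \<omega> where a: "a = (g, \<omega>)" by (cases a)
  then obtain s where "\<omega> \<in> B" "implements G P g \<omega> s"
    using assms arrow_iff by auto
  moreover have "\<omega> \<in> \<Omega>" using \<open>\<omega> \<in> B\<close> by simp
  moreover have "g \<in> carrier G" using calculation by (simp add: implements_iff)
  ultimately show ?thesis using that a by blast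
qed

text \<open>The group is discrete, so fixing g is an open condition and local questions about arrows
  become questions about \<omega> alone.\<close>

lemma openin_slice:
  assumes "g \<in> carrier G" "openin BT W"
  shows "openin AT (topspace AT \<inter> {g} \<times> W)"
proof -
  have "openin (prod_topology (discrete_topology (carrier G)) BT) ({g} \<times> W)"
    using assms by (simp add: openin_prod_Times_iff)
  then have "openin AT ({(g, \<omega>). g \<in> carrier G \<and> \<omega> \<in> B \<and> \<omega> \<in> action_domain G P g} \<inter> {g} \<times> W)"
    unfolding AT_eq by (rule openin_subtopology_Int2)
  moreover have "topspace AT =
      {(g, \<omega>). g \<in> carrier G \<and> \<omega> \<in> B \<and> \<omega> \<in> action_domain G P g}"
    unfolding AT_eq by auto
  ultimately show ?thesis by simp
qed

section \<open>Continuity of the structure maps\<close>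

lemma continuous_arrow_fst: "continuous_map AT (discrete_topology (carrier G)) fst"
  unfolding AT_eq by (rule continuous_map_from_subtopology[OF continuous_map_fst])

lemma continuous_arrow_snd: "continuous_map AT BT snd"
  unfolding AT_eq by (rule continuous_map_from_subtopology[OF continuous_map_snd])

lemma continuous_arrowI:
  assumes "continuous_map X (discrete_topology (carrier G)) f" "continuous_map X BT h"
    "\<And>x. x \<in> topspace X \<Longrightarrow> (f x, h x) \<in> topspace AT"
  shows "continuous_map X AT (\<lambda>x. (f x, h x))"
proof -
  have "(\<lambda>x. (f x, h x)) \<in>
      topspace X \<rightarrow> {(g, \<omega>). g \<in> carrier G \<and> \<omega> \<in> B \<and> \<omega> \<in> action_domain G P g}"
    using assms(3) unfolding AT_eq topspace_subtopology by blast
  then show ?thesis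
    unfolding AT_eq by (intro continuous_map_into_subtopology continuous_map_pairedI assms(1,2))
qed

lemma rng_in_B: "a \<in> topspace AT \<Longrightarrow> rng \<G> a \<in> B"
  by (elim arrow_cases) (simp add: act_boundary)

lemma continuous_arrow_rng: "continuous_map AT BT (rng \<G>)"
  unfolding continuous_map_def
proof (intro conjI allI impI)
  show "rng \<G> \<in> topspace AT \<rightarrow> topspace BT"
    using rng_in_B by simp
  fix W assume W: "openin BT W"
  show "openin AT {a \<in> topspace AT. rng \<G> a \<in> W}"
  proof (subst openin_subopen, intro ballI)
    fix a assume a: "a \<in> {a \<in> topspace AT. rng \<G> a \<in> W}"
    then have "a \<in> topspace AT" by simp
    then obtain g \<omega> s where a': "a = (g, \<omega>)" "g \<in> carrier G" "\<omega> \<in> B" "\<omega> \<in> \<Omega>"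
      "implements G P g \<omega> s"
      by (rule arrow_cases)
    then have "\<exists>F. finite F \<and> F \<subseteq> J \<and> (\<forall>\<psi>\<in>B. (\<forall>X\<in>F. \<psi> X = act g \<omega> X) \<longrightarrow> \<psi> \<in> W)"
      using a W unfolding openin_BT by simp
    then obtain F where F: "finite F" "F \<subseteq> J"
      "\<forall>\<psi>\<in>B. (\<forall>X\<in>F. \<psi> X = act g \<omega> X) \<longrightarrow> \<psi> \<in> W"
      by blast
    obtain F' where F': "finite F'" "F' \<subseteq> J"
      "\<forall>\<psi>\<in>\<Omega>. (\<forall>X\<in>F'. \<psi> X = \<omega> X) \<longrightarrow>
        implements G P g \<psi> s \<and> (\<forall>X\<in>F. act g \<psi> X = act g \<omega> X)"
      using act_cylinder[OF a'(4,5) F(1,2)] .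
    \<comment> \<open>With g fixed, agreement with \<omega> on F' keeps s usable and makes the
      translate agree on F with that of \<omega>, which forces it into W.\<close>
    let ?N = "topspace AT \<inter> {g} \<times> {\<psi> \<in> B. \<forall>X\<in>F'. \<psi> X = \<omega> X}"
    have "openin AT ?N"
      by (rule openin_slice[OF a'(2) openin_BT_cylinder[OF F'(1,2)]])
    moreover have "a \<in> ?N" using a a' by simp
    moreover have "?N \<subseteq> {a \<in> topspace AT. rng \<G> a \<in> W}"
    proof
      fix b assume b: "b \<in> ?N"
      then obtain \<psi> where \<psi>: "b = (g, \<psi>)" "\<psi> \<in> B" "\<forall>X\<in>F'. \<psi> X = \<omega> X" by auto
      then have "implements G P g \<psi> s \<and> (\<forall>X\<in>F. act g \<psi> X = act g \<omega> X)"
        using F'(3) by simp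
      then have "act g \<psi> \<in> W" using F(3) act_boundary[OF \<psi>(2)] by blast
      then show "b \<in> {a \<in> topspace AT. rng \<G> a \<in> W}" using b \<psi>(1) by simp
    qed
    ultimately show "\<exists>T. openin AT T \<and> a \<in> T \<and> T \<subseteq> {a \<in> topspace AT. rng \<G> a \<in> W}"
      by blast
  qed
qed

lemma ginv_arrow:
  assumes "a \<in> topspace AT"
  shows "ginv \<G> a \<in> topspace AT"
proof -
  obtain g \<omega> s where a: "a = (g, \<omega>)" "\<omega> \<in> B" "\<omega> \<in> \<Omega>" "implements G P g \<omega> s"
    using assms by (rule arrow_cases)
  show ?thesis
    unfolding a(1) groupoid_simps arrow_iff
    using act_boundary[OF a(2,4)] implements_converse[OF a(3,4)] by blast
qed

text \<open>Makes inversion a homeomorphism of the arrow space and later gives injectivity of the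
  range map on slices.\<close>

lemma ginv_ginv: "a \<in> topspace AT \<Longrightarrow> ginv \<G> (ginv \<G> a) = a"
  by (elim arrow_cases) (simp add: act_inv)

lemma ginv_eq: "ginv \<G> = (\<lambda>a. (inv (fst a), rng \<G> a))"
  by (auto simp: fun_eq_iff)

lemma continuous_arrow_ginv: "continuous_map AT AT (ginv \<G>)"
  unfolding ginv_eq
proof (rule continuous_arrowI[OF _ continuous_arrow_rng])
  have "continuous_map (discrete_topology (carrier G)) (discrete_topology (carrier G)) (\<lambda>g. inv g)"
    by simp
  from continuous_map_compose[OF continuous_arrow_fst this]
  show "continuous_map AT (discrete_topology (carrier G)) (\<lambda>a. inv (fst a))"
    by (simp add: o_def)
  show "(inv (fst a), rng \<G> a) \<in> topspace AT" if "a \<in> topspace AT" for a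
    using ginv_arrow[OF that] by (simp add: ginv_eq)
qed

lemma composable_cases:
  assumes "(a, b) \<in> composable \<G>"
  obtains g h \<omega> s t where "a = (g, act h \<omega>)" "b = (h, \<omega>)" "g \<in> carrier G" "h \<in> carrier G"
    "\<omega> \<in> B" "\<omega> \<in> \<Omega>" "implements G P h \<omega> s" "implements G P g (act h \<omega>) t"
proof -
  have ab: "a \<in> topspace AT" "b \<in> topspace AT" "snd a = rng \<G> b"
    using assms by (auto simp: composable_def)
  obtain h \<omega> s where b: "b = (h, \<omega>)" "h \<in> carrier G" "\<omega> \<in> B" "\<omega> \<in> \<Omega>" "implements G P h \<omega> s"
    using arrow_cases[OF ab(2)] .
  obtain g \<psi> t where a: "a = (g, \<psi>)" "g \<in> carrier G" "implements G P g \<psi> t"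
    using arrow_cases[OF ab(1)] by metis
  have "\<psi> = act h \<omega>" using ab(3) a(1) b(1) by simp
  then show ?thesis using that a b by blast
qed

lemma gmult_arrow:
  assumes "(a, b) \<in> composable \<G>"
  shows "gmult \<G> a b \<in> topspace AT"
proof -
  obtain g h \<omega> s t where ab: "a = (g, act h \<omega>)" "b = (h, \<omega>)" "\<omega> \<in> B" "\<omega> \<in> \<Omega>"
    "implements G P h \<omega> s" "implements G P g (act h \<omega>) t"
    using assms by (rule composable_cases)
  show ?thesis
    unfolding ab(1,2) groupoid_simps arrow_iff
    using ab(3) implements_comp[OF ab(4-6)] by blast
qed

lemma gmult_eq: "gmult \<G> a b = (fst a \<otimes> fst b, snd b)"
  by (cases a; cases b) simp

text \<open>The product keeps the unit coordinate of its second factor and combines the group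
  coordinates by a map between discrete spaces, so the coordinates can be treated
  separately.\<close>

lemma continuous_arrow_gmult:
  "continuous_map (subtopology (prod_topology AT AT) (composable \<G>)) AT (\<lambda>(a, b). gmult \<G> a b)"
proof -
  let ?C = "subtopology (prod_topology AT AT) (composable \<G>)"
  let ?D = "discrete_topology (carrier G)"
  have fst: "continuous_map ?C AT fst" and snd: "continuous_map ?C AT snd"
    by (intro continuous_map_from_subtopology continuous_map_fst continuous_map_snd)+
  have "continuous_map ?C (prod_topology ?D ?D) (\<lambda>x. (fst (fst x), fst (snd x)))"
    using continuous_map_compose[OF fst continuous_arrow_fst]
      continuous_map_compose[OF snd continuous_arrow_fst]
    by (intro continuous_map_pairedI) (simp_all add: o_def)
  moreover have "continuous_map (prod_topology ?D ?D) ?D (\<lambda>(g, h). g \<otimes> h)"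
    unfolding prod_topology_discrete_topology[symmetric] by auto
  ultimately have "continuous_map ?C ?D ((\<lambda>(g, h). g \<otimes> h) \<circ> (\<lambda>x. (fst (fst x), fst (snd x))))"
    by (rule continuous_map_compose)
  then have 1: "continuous_map ?C ?D (\<lambda>x. fst (fst x) \<otimes> fst (snd x))"
    by (simp add: o_def)
  have 2: "continuous_map ?C BT (\<lambda>x. snd (snd x))"
    using continuous_map_compose[OF snd continuous_arrow_snd] by (simp add: o_def)
  have "continuous_map ?C AT (\<lambda>x. (fst (fst x) \<otimes> fst (snd x), snd (snd x)))"
  proof (rule continuous_arrowI[OF 1 2])
    fix x assume "x \<in> topspace ?C"
    then have "(fst x, snd x) \<in> composable \<G>" by simp
    then show "(fst (fst x) \<otimes> fst (snd x), snd (snd x)) \<in> topspace AT"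
      using gmult_arrow gmult_eq by metis
  qed
  then show ?thesis by (simp add: gmult_eq case_prod_unfold)
qed

lemma topological_groupoid: "topological_groupoid \<G>"
proof
  show "continuous_map AT (units \<G>) (src \<G>)" "continuous_map AT (units \<G>) (rng \<G>)"
    using continuous_arrow_snd continuous_arrow_rng by simp_all
  show "continuous_map AT AT (ginv \<G>)" by (rule continuous_arrow_ginv)
  show "continuous_map (subtopology (prod_topology AT AT) (composable \<G>)) AT (\<lambda>(a, b). gmult \<G> a b)"
    by (rule continuous_arrow_gmult)
  have "continuous_map BT AT (\<lambda>\<omega>. (\<one>, \<omega>))"
  proof (rule continuous_arrowI)
    show "continuous_map BT BT (\<lambda>\<omega>. \<omega>)" by (simp add: continuous_map_id[unfolded id_def])
    fix \<omega> assume "\<omega> \<in> topspace BT"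
    then have "\<omega> \<in> B" by simp
    then show "(\<one>, \<omega>) \<in> topspace AT"
      using implements_one[OF B_char] arrow_iff by blast
  qed simp
  then show "continuous_map (units \<G>) AT (ident \<G>)"
    by (simp add: boundary_groupoid_def)
next
  fix x assume "x \<in> topspace (units \<G>)"
  then have "x \<in> \<Omega>" by simp
  then show "src \<G> (ident \<G> x) = x" "rng \<G> (ident \<G> x) = x"
    by (simp_all add: act_one)
next
  fix a b assume ab: "(a, b) \<in> composable \<G>"
  show "src \<G> (gmult \<G> a b) = src \<G> b" by (simp add: gmult_eq)
  show "rng \<G> (gmult \<G> a b) = rng \<G> a"
    using ab by (elim composable_cases) (simp add: act_comp)
  fix c assume bc: "(b, c) \<in> composable \<G>"
  have "fst x \<in> carrier G" if "x \<in> topspace AT" for x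
    using that by (elim arrow_cases) simp
  then have "fst a \<in> carrier G" "fst b \<in> carrier G" "fst c \<in> carrier G"
    using ab bc by (auto simp: composable_def)
  then show "gmult \<G> (gmult \<G> a b) c = gmult \<G> a (gmult \<G> b c)"
    by (simp add: gmult_eq m_assoc)
next
  fix a assume "a \<in> topspace AT"
  then obtain g \<omega> s where a: "a = (g, \<omega>)" "g \<in> carrier G" "\<omega> \<in> B" "\<omega> \<in> \<Omega>"
    "implements G P g \<omega> s"
    by (rule arrow_cases)
  then show "gmult \<G> a (ident \<G> (src \<G> a)) = a" "gmult \<G> (ident \<G> (rng \<G> a)) a = a"
    "src \<G> (ginv \<G> a) = rng \<G> a" "rng \<G> (ginv \<G> a) = src \<G> a"
    "gmult \<G> (ginv \<G> a) a = ident \<G> (src \<G> a)"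
    "gmult \<G> a (ginv \<G> a) = ident \<G> (rng \<G> a)"
    by (simp_all add: act_inv)
qed

section \<open>The etale property\<close>

lemma openin_action_domain: "openin BT (B \<inter> action_domain G P g)"
proof (subst openin_subopen, intro ballI)
  fix \<omega> assume "\<omega> \<in> B \<inter> action_domain G P g"
  then obtain s where s: "\<omega> \<in> B" "\<omega> \<in> \<Omega>" "implements G P g \<omega> s"
    by (auto simp: action_domain_iff)
  \<comment> \<open>With no coordinates of the translate to control, what remains is that the same s
    implements g throughout a neighbourhood.\<close>
  obtain F where F: "finite F" "F \<subseteq> J"
    "\<forall>\<psi>\<in>\<Omega>. (\<forall>X\<in>F. \<psi> X = \<omega> X) \<longrightarrow>
      implements G P g \<psi> s \<and> (\<forall>X\<in>{}. act g \<psi> X = act g \<omega> X)"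
    using act_cylinder[OF s(2,3) finite.emptyI empty_subsetI] .
  have "{\<psi> \<in> B. \<forall>X\<in>F. \<psi> X = \<omega> X} \<subseteq> B \<inter> action_domain G P g"
    using F(3) B_char action_domain_iff by blast
  then show "\<exists>T. openin BT T \<and> \<omega> \<in> T \<and> T \<subseteq> B \<inter> action_domain G P g"
    using openin_BT_cylinder[OF F(1,2), of \<omega>] s(1)
    by (intro exI[of _ "{\<psi> \<in> B. \<forall>X\<in>F. \<psi> X = \<omega> X}"]) simp
qed

text \<open>The arrows over a fixed g form a slice above an open domain. Openness in the full
  product is what passes local compactness down to the arrow space.\<close>

lemma openin_arrows:
  "openin (prod_topology (discrete_topology (carrier G)) BT)
     {(g, \<omega>). g \<in> carrier G \<and> \<omega> \<in> B \<and> \<omega> \<in> action_domain G P g}" (is "openin ?T ?A")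
proof -
  have "?A = (\<Union>g\<in>carrier G. {g} \<times> (B \<inter> action_domain G P g))" by auto
  also have "openin ?T \<dots>"
    using openin_action_domain by (intro openin_Union) (auto simp: openin_prod_Times_iff)
  finally show ?thesis .
qed

lemma Hausdorff_AT: "Hausdorff_space AT"
  unfolding AT_eq
  by (intro Hausdorff_space_subtopology iffD2[OF Hausdorff_space_prod_topology] disjI2 conjI
      Hausdorff_BT Hausdorff_space_discrete_topology)

lemma locally_compact_AT: "locally_compact_space AT"
  unfolding AT_eq
  by (intro locally_compact_space_open_subset openin_arrows disjI1
      iffD2[OF Hausdorff_space_prod_topology] iffD2[OF locally_compact_space_prod_topology]
      disjI2 conjI Hausdorff_BT Hausdorff_space_discrete_topology
      compact_imp_locally_compact_space compact_BT locally_compact_space_discrete_topology)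

lemma slice_in_arrows:
  "W \<subseteq> B \<inter> action_domain G P g \<Longrightarrow> {g} \<times> W \<subseteq> topspace AT"
  by (simp add: subset_iff arrow_iff action_domain_iff)

lemma continuous_slice:
  assumes "g \<in> carrier G" "W \<subseteq> B \<inter> action_domain G P g"
  shows "continuous_map (subtopology BT W) AT (\<lambda>\<omega>. (g, \<omega>))"
proof (rule continuous_arrowI)
  show "continuous_map (subtopology BT W) BT (\<lambda>\<omega>. \<omega>)"
    by (rule continuous_map_from_subtopology[OF continuous_map_id[unfolded id_def]])
qed (use assms slice_in_arrows[OF assms(2)] in auto)

text \<open>All arrows with the same group element g form a chart, whose inverse attaches g to a
  character.\<close>

lemma local_homeomorphism_snd: "local_homeomorphism_map AT BT snd"
  unfolding local_homeomorphism_map_def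
proof
  fix a assume "a \<in> topspace AT"
  then obtain g \<omega> s where a: "a = (g, \<omega>)" "g \<in> carrier G" "\<omega> \<in> B" "\<omega> \<in> \<Omega>"
    "implements G P g \<omega> s"
    by (rule arrow_cases)
  let ?W = "B \<inter> action_domain G P g"
  let ?U = "{g} \<times> ?W"
  have "topspace AT \<inter> ?U = ?U" using slice_in_arrows[of ?W g] by blast
  then have U: "openin AT ?U" using openin_slice[OF a(2) openin_action_domain, of g] by simp
  have img: "snd ` ?U = ?W" by force
  have "homeomorphic_maps (subtopology AT ?U) (subtopology BT ?W) snd (\<lambda>\<omega>. (g, \<omega>))"
    unfolding homeomorphic_maps_def
  proof (intro conjI ballI)
    show "continuous_map (subtopology AT ?U) (subtopology BT ?W) snd"
      by (intro continuous_map_into_subtopology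
          continuous_map_from_subtopology[OF continuous_arrow_snd]) auto
    show "continuous_map (subtopology BT ?W) (subtopology AT ?U) (\<lambda>\<omega>. (g, \<omega>))"
      by (intro continuous_map_into_subtopology continuous_slice a) auto
  qed auto
  then have "homeomorphic_map (subtopology AT ?U) (subtopology BT ?W) snd"
    using homeomorphic_map_maps by blast
  then show "\<exists>U. openin AT U \<and> a \<in> U \<and> openin BT (snd ` U) \<and>
      homeomorphic_map (subtopology AT U) (subtopology BT (snd ` U)) snd"
    using U a img openin_action_domain
    by (intro exI[of _ ?U]) (auto simp: action_domain_iff)
qed

text \<open>The range map is the source map after inversion, so a source chart at the inverse arrow
  is carried back by the homeomorphism \<open>ginv \<G>\<close>.\<close>

lemma local_homeomorphism_rng: "local_homeomorphism_map AT BT (rng \<G>)"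
  unfolding local_homeomorphism_map_def
proof
  fix a assume a: "a \<in> topspace AT"
  obtain V where V: "openin AT V" "ginv \<G> a \<in> V" "openin BT (snd ` V)"
    "homeomorphic_map (subtopology AT V) (subtopology BT (snd ` V)) snd"
    using local_homeomorphism_snd ginv_arrow[OF a] unfolding local_homeomorphism_map_def by blast
  have sub: "V \<subseteq> topspace AT" using openin_subset[OF V(1)] .
  have h: "homeomorphic_map AT AT (ginv \<G>)"
    using homeomorphic_map_involution[OF continuous_arrow_ginv ginv_ginv] .
  define U where "U = ginv \<G> ` V"
  have U: "openin AT U"
    unfolding U_def using homeomorphic_map_openness[OF h sub] V(1) by simp
  have Usub: "U \<subseteq> topspace AT" using openin_subset[OF U] .
  have img: "ginv \<G> ` U = V"
  proof -
    have "(\<lambda>a. ginv \<G> (ginv \<G> a)) ` V = (\<lambda>a. a) ` V"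
      by (rule image_cong) (use ginv_ginv sub in blast)+
    then show ?thesis unfolding U_def image_image image_ident .
  qed
  have "homeomorphic_map (subtopology AT U) (subtopology AT V) (ginv \<G>)"
    using homeomorphic_map_subtopologies[OF h, of U V] img Usub sub by (simp add: Int_absorb1)
  then have "homeomorphic_map (subtopology AT U) (subtopology BT (snd ` V)) (snd \<circ> ginv \<G>)"
    using V(4) by (rule homeomorphic_map_compose)
  then have "homeomorphic_map (subtopology AT U) (subtopology BT (snd ` V)) (rng \<G>)"
    by (rule homeomorphic_map_eq) (simp add: ginv_eq)
  moreover have "rng \<G> ` U = snd ` V"
    unfolding img[symmetric] image_image by (simp add: ginv_eq)
  moreover have "a \<in> U"
    unfolding U_def using V(2) ginv_ginv[OF a] by force
  ultimately show "\<exists>U. openin AT U \<and> a \<in> U \<and> openin BT (rng \<G> ` U) \<and>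
      homeomorphic_map (subtopology AT U) (subtopology BT (rng \<G> ` U)) (rng \<G>)"
    using U V(3) by (intro exI[of _ U]) simp
qed

lemma etale_groupoid: "etale_groupoid \<G>"
  by (intro etale_groupoid.intro etale_groupoid_axioms.intro topological_groupoid)
     (simp_all add: Hausdorff_AT locally_compact_AT local_homeomorphism_snd local_homeomorphism_rng)

section \<open>Pure infiniteness\<close>

lemma implements_left_translation:
  assumes "p \<in> P" "\<omega> \<in> \<Omega>"
  shows "implements G P p \<omega> (left_translation p)"
proof -
  have "Domain (left_translation p) = P" by auto
  then show ?thesis
    using assms char_P left_inverse_hull.gen[OF assms(1)] by (auto simp: implements_iff)
qed

text \<open>The preimage of pP under translation by p is all of P. The coset thus marks every
  translate by p, which is how the two ranges are located and separated.\<close>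

lemma act_l_coset:
  assumes "p \<in> P" "\<omega> \<in> \<Omega>"
  shows "act p \<omega> (p <# P) = 1"
proof -
  have "(left_translation p)\<inverse> `` (p <# P) = P" by (auto simp: l_coset_def)
  then show ?thesis
    using act_eq[OF assms(2) implements_left_translation[OF assms] J_l_coset[OF assms(1) P_in_J]]
      char_P[OF assms(2)] by simp
qed

lemma translation_bisection:
  assumes p: "p \<in> P" and A: "compactin BT A" "openin BT A"
  shows "compact_open_bisection \<G> ({p} \<times> A)"
  unfolding compact_open_bisection_def
proof (intro conjI)
  have AB: "A \<subseteq> B" using openin_subset[OF A(2)] by simp
  have dom: "A \<subseteq> B \<inter> action_domain G P p"
    using AB B_subset implements_left_translation[OF p] by (fastforce simp: action_domain_iff)
  have slice: "(\<lambda>\<omega>. (p, \<omega>)) ` A = {p} \<times> A" by auto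
  have "compactin (subtopology BT A) A"
    using A(1) by (simp add: compactin_subtopology)
  from image_compactin[OF this continuous_slice[OF P_carrierD[OF p] dom]]
  show "compactin AT ({p} \<times> A)" by (simp add: slice)
  show "openin AT ({p} \<times> A)"
    using openin_slice[OF P_carrierD[OF p] A(2)] slice_in_arrows[OF dom]
    by (simp add: Int_absorb1)
  show "inj_on (src \<G>) ({p} \<times> A)" by (auto simp: inj_on_def)
  show "inj_on (rng \<G>) ({p} \<times> A)"
  proof (rule inj_onI)
    fix a b assume ab: "a \<in> {p} \<times> A" "b \<in> {p} \<times> A" "rng \<G> a = rng \<G> b"
    have "a \<in> topspace AT" "b \<in> topspace AT"
      using ab slice_in_arrows[OF dom] by auto
    then have "ginv \<G> (ginv \<G> a) = a" "ginv \<G> (ginv \<G> b) = b"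
      by (simp_all add: ginv_ginv)
    \<comment> \<open>On a slice the inverse arrows share their group coordinate, so equal ranges
      give equal inverses.\<close>
    moreover have "ginv \<G> a = ginv \<G> b" using ab by (auto simp: ginv_eq)
    ultimately show "a = b" by metis
  qed
qed

lemma purely_infinite:
  assumes pq: "p \<in> P" "q \<in> P" "(p <# P) \<inter> (q <# P) = {}"
  shows "purely_infinite \<G>"
  unfolding purely_infinite_def
proof (intro conjI allI impI)
  show "etale_groupoid \<G>" by (rule etale_groupoid)
  show "totally_disconnected_top (units \<G>)" using totally_disconnected_BT by simp
  fix A assume "compactin (units \<G>) A \<and> openin (units \<G>) A"
  then have A: "compactin BT A" "openin BT A" by simp_all
  then have AB: "A \<subseteq> B" using openin_subset by fastforce
  \<comment> \<open>For empty A any x in P will do, and the same formulas then give empty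
    bisections.\<close>
  obtain x where x: "x \<in> P" "A \<noteq> {} \<Longrightarrow> \<exists>X\<in>J. x \<in> X \<and> (\<forall>\<psi>\<in>B. \<psi> X = 1 \<longrightarrow> \<psi> \<in> A)"
  proof (cases "A = {}")
    case True
    then show ?thesis using that P_nonempty by blast
  next
    case False
    then obtain X where X: "X \<in> J" "X \<noteq> {}" "\<forall>\<psi>\<in>B. \<psi> X = 1 \<longrightarrow> \<psi> \<in> A"
      using openin_BT_contains_ideal[OF A(2)] by blast
    then obtain x where "x \<in> X" by blast
    then show ?thesis using that X J_subset[OF X(1)] by blast
  qed
  have into: "act (x \<otimes> r) \<omega> \<in> A" if r: "r \<in> P" and \<omega>: "\<omega> \<in> A" for r \<omega>
  proof -
    obtain X where X: "X \<in> J" "x \<in> X" "\<forall>\<psi>\<in>B. \<psi> X = 1 \<longrightarrow> \<psi> \<in> A" using x(2) \<omega> by blast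
    have xr: "x \<otimes> r \<in> P" using x(1) r by (rule P_mult)
    have \<omega>B: "\<omega> \<in> B" "\<omega> \<in> \<Omega>" using \<omega> AB by auto
    note i = implements_left_translation[OF xr \<omega>B(2)]
    \<comment> \<open>X is a right ideal containing x, and (x r) y = x (r y).\<close>
    have "(x \<otimes> r) <# P \<subseteq> X"
      using J_right_ideal[OF X(1,2)] P_mult r x(1) by (auto simp: l_coset_def m_assoc)
    then have "act (x \<otimes> r) \<omega> X = 1"
      using char_mono[OF act_in_characters[OF \<omega>B(2) i] J_l_coset[OF xr P_in_J] X(1)]
        act_l_coset[OF xr \<omega>B(2)] by simp
    then show ?thesis using X(3) act_boundary[OF \<omega>B(1) i] by blast
  qed
  have disj: "act (x \<otimes> p) \<omega> \<noteq> act (x \<otimes> q) \<psi>" if "\<omega> \<in> A" "\<psi> \<in> A" for \<omega> \<psi>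
  proof
    assume eq: "act (x \<otimes> p) \<omega> = act (x \<otimes> q) \<psi>"
    have xp: "x \<otimes> p \<in> P" "x \<otimes> q \<in> P" using x(1) pq P_mult by auto
    have \<omega>\<psi>: "\<omega> \<in> \<Omega>" "\<psi> \<in> \<Omega>" using that AB by auto
    note chi = act_in_characters[OF \<omega>\<psi>(1) implements_left_translation[OF xp(1) \<omega>\<psi>(1)]]
    have "((x \<otimes> p) <# P) \<inter> ((x \<otimes> q) <# P) = {}"
    proof (rule equals0I)
      fix z assume "z \<in> ((x \<otimes> p) <# P) \<inter> ((x \<otimes> q) <# P)"
      then obtain u v where uv: "u \<in> P" "v \<in> P" "x \<otimes> p \<otimes> u = x \<otimes> q \<otimes> v"
        by (auto simp: l_coset_def)
      \<comment> \<open>Cancelling x shows that left multiplication preserves the disjointness of pP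
        and qP.\<close>
      then have "p \<otimes> u = q \<otimes> v"
        using x(1) pq(1,2) by (simp add: m_assoc)
      moreover have "p \<otimes> u \<in> p <# P" "q \<otimes> v \<in> q <# P"
        using uv(1,2) by (auto simp: l_coset_def)
      ultimately show False using pq(3) by auto
    qed
    \<comment> \<open>A common translate would be 1 at both cosets, hence at their empty
      intersection.\<close>
    moreover have "act (x \<otimes> p) \<omega> (((x \<otimes> p) <# P) \<inter> ((x \<otimes> q) <# P)) = 1"
      using char_Int[OF chi J_l_coset[OF xp(1) P_in_J] J_l_coset[OF xp(2) P_in_J]]
        act_l_coset[OF xp(1) \<omega>\<psi>(1)] act_l_coset[OF xp(2) \<omega>\<psi>(2)] eq by simp
    ultimately show False using char_empty[OF chi] by simp
  qed
  have "rng \<G> ` ({x \<otimes> p} \<times> A) \<union> rng \<G> ` ({x \<otimes> q} \<times> A) \<subseteq> A"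
    using into pq by auto
  moreover have "rng \<G> ` ({x \<otimes> p} \<times> A) \<inter> rng \<G> ` ({x \<otimes> q} \<times> A) = {}"
    using disj by fastforce
  ultimately show "\<exists>U V. compact_open_bisection \<G> U \<and> compact_open_bisection \<G> V \<and>
      src \<G> ` U = A \<and> src \<G> ` V = A \<and>
      rng \<G> ` U \<union> rng \<G> ` V \<subseteq> A \<and> rng \<G> ` U \<inter> rng \<G> ` V = {}"
    using translation_bisection[OF P_mult[OF x(1)] A] pq(1,2)
    by (intro exI[of _ "{x \<otimes> p} \<times> A"] exI[of _ "{x \<otimes> q} \<times> A"]) simp
qed

end

theorem theorem4p5:
  fixes G :: "('a, 'b) monoid_scheme" (structure) and P :: "'a set"
  assumes "group G" and "countable (carrier G)"
    and "P \<subseteq> carrier G" and "\<And>x y. x \<in> P \<Longrightarrow> y \<in> P \<Longrightarrow> x \<otimes> y \<in> P"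
    and "\<exists>p\<in>P. \<exists>q\<in>P. (p <# P) \<inter> (q <# P) = {}"
  shows "purely_infinite (boundary_groupoid G P)"
proof -
  obtain p q where pq: "p \<in> P" "q \<in> P" "(p <# P) \<inter> (q <# P) = {}"
    using assms(5) by blast
  interpret group_subsemigroup G P
    using assms(1,3,4) pq(1)
    by (auto simp: group_subsemigroup_def group_subsemigroup_axioms_def)
  show ?thesis by (rule purely_infinite[OF pq])
qed

end
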